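(* Let $H$, $A$, $A_1,\dots,A_m$, $\eta_1,\dots,\eta_m$, $M$, $f$, $\varphi_0,\varphi_1$, $T$, $n>1$, $\tau=T/n$, $t_k=k\tau$ and the scheme values $v_0,\dots,v_n$ be as described in the context. Suppose the Cauchy problem $$u''(t)+Au(t)+M(u(t))=f(t),\quad t\in[0,T],\qquad u(0)=\varphi_0,\quad u'(0)=\varphi_1$$ has a solution $u$ and $\varphi_0\in D(A)$. Put $z_k=v_k-u(t_k)$ and $\Delta z_k=z_{k+1}-z_k$. Then for every $k=1,\dots,n-1$, $$\left\|\frac{\Delta z_k}{\tau}\right\|\le\left\|\frac{\Delta z_0}{\tau}\right\|+(\tau t_k)^{-1/2}\|z_0\|+\widetilde\Theta_k(\tau),$$ where $$\begin{aligned}\widetilde\Theta_k(\tau)={}&\tau\sum_{i=1}^k\left[c_5J_i(t_{i-1},u'')+J_i(t_{i+1},u'')+a\,c_6J_i(t_{i-1},u)\right]\\&+\tau\sum_{i=1}^k\left[c_7J_i(t_{i-1},f)+J_i(t_{i+1},f)\right]\\&+\sum_{i=1}^k\left(\int_{t_{i-1}}^{t_{i+1}}J_i(t,u'')\,dt+\tau a\|z_i\|\right)\\&+\tau\left[c_1\|A\varphi_0\|+c_6\left(\|f(0)\|+\|M(\varphi_0)\|\right)\right],\end{aligned}$$ with $J_i(t,w)=\|w(t_i)-w(t)\|$ for an $H$-valued function $w$ on $[0,T]$, and $$a_j=\|A_jA^{-1}\|<\infty,\quad c_0=\sum_{j=1}^m\eta_j^{-1/2}a_j,\quad c_1=\sum_{j=1}^m\eta_j^{-3/2}(\eta_j^{-1}a_j+1),\quad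 c_4=\sum_{j=1}^m\eta_j^{-1}(\eta_j^{-1}a_j+1),$$ $$c_5=c_4+c_1,\quad c_6=\eta_1^{-1/2}+m+c_0,\quad c_7=c_4+c_1+c_6.$$
   Context: $H$ is a Hilbert space with norm $\|\cdot\|$ and inner product $(\cdot,\cdot)$. $A$ is a self-adjoint, positive definite (generally unbounded) operator with dense domain $D(A)\subset H$: $A=A^*$ and $(Au,u)\ge\alpha\|u\|^2$ for all $u\in D(A)$, with a constant $\alpha>0$. Moreover $A=\sum_{j=1}^mA_j$ as unbounded operators (so $D(A)=\bigcap_jD(A_j)$), where each $A_j=A_j^*\ge\alpha_jI$ with constant $\alpha_j>0$. The nonlinear operator $M:H\to H$ satisfies $\|M(u)-M(v)\|\le a\|u-v\|$ for all $u,v\in H$, with a constant $a>0$. $f:[0,T]\to H$ is a given continuous function, $T>0$, and $\varphi_0,\varphi_1\in H$ are given vectors. A solution of the Cauchy problem is a function $u:[0,T]\to H$ such that (a) $u$ is twice continuously differentiable on $[0,T]$; (b) $u(t)\in D(A)$ for all $t\in[0,T]$, and $Au(t)$ and $M(u(t))$ are continuous in $t$; (c) $u$ satisfies the equation on $[0,T]$ and the initial conditions. Scheme: fix weights $\eta_j$ with $0<\eta_j<1$, $\sum_{j=1}^m\eta_j=1$, an integer $n>1$, $\tau=T/n$, $t_k=k\tau$. Set $v_0=\varphi_0$, $v_1=\varphi_0+\tau\varphi_1$, and for $k=1,\dots,n-1$ set $v_{k+1}=\sum_{j=1}^m\eta_jy_{j,k+1}$, where $y_{j,k+1}$ ($j=1,\dots,m$)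 solves $$\eta_j\frac{y_{j,k+1}-2v_k+v_{k-1}}{\tau^2}+A_jy_{j,k+1}=\delta_{1,j}\left[f(t_k)-M(v_k)\right],$$ with $\delta_{1,j}$ the Kronecker symbol. *)

theory Defs
  imports "HOL-Analysis.Analysis"
begin

text \<open>
  An unbounded operator is given by its domain \<open>D\<close> and a total function \<open>A\<close> whose values
  outside \<open>D\<close> are irrelevant. The Hilbert space is a real one; a complex Hilbert space is covered
  by taking the real part of its inner product, which changes neither the norm nor the notions
  of adjoint and of lower bound for a symmetric operator.
\<close>

definition linear_operator_on :: "'h::real_vector set \<Rightarrow> ('h \<Rightarrow> 'h) \<Rightarrow> bool" where
  "linear_operator_on D A \<longleftrightarrow>
     subspace D \<and>
     (\<forall>x\<in>D. \<forall>y\<in>D. A (x + y) = A x + A y) \<and>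
     (\<forall>c. \<forall>x\<in>D. A (c *\<^sub>R x) = c *\<^sub>R A x)"

definition adjoint_domain :: "'h::real_inner set \<Rightarrow> ('h \<Rightarrow> 'h) \<Rightarrow> 'h set" where
  "adjoint_domain D A = {v. \<exists>w. \<forall>u\<in>D. A u \<bullet> v = u \<bullet> w}"

text \<open>For dense \<open>D\<close> and \<open>v\<close> in the domain of the adjoint, the vector \<open>w\<close> below is unique.\<close>

definition adjoint_operator :: "'h::real_inner set \<Rightarrow> ('h \<Rightarrow> 'h) \<Rightarrow> 'h \<Rightarrow> 'h" where
  "adjoint_operator D A v = (THE w. \<forall>u\<in>D. A u \<bullet> v = u \<bullet> w)"

definition self_adjoint_operator :: "'h::real_inner set \<Rightarrow> ('h \<Rightarrow> 'h) \<Rightarrow> bool" where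
  "self_adjoint_operator D A \<longleftrightarrow>
     linear_operator_on D A \<and> closure D = UNIV \<and>
     adjoint_domain D A = D \<and> (\<forall>v\<in>D. adjoint_operator D A v = A v)"

definition operator_bounded_below :: "'h::real_inner set \<Rightarrow> ('h \<Rightarrow> 'h) \<Rightarrow> real \<Rightarrow> bool" where
  "operator_bounded_below D A \<alpha> \<longleftrightarrow> (\<forall>u\<in>D. A u \<bullet> u \<ge> \<alpha> * (norm u)\<^sup>2)"

definition operator_sum_eq ::
  "'h::real_vector set \<Rightarrow> ('h \<Rightarrow> 'h) \<Rightarrow> nat \<Rightarrow> (nat \<Rightarrow> 'h set) \<Rightarrow> (nat \<Rightarrow> 'h \<Rightarrow> 'h) \<Rightarrow> bool" where
  "operator_sum_eq D A m DA AA \<longleftrightarrow>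
     D = (\<Inter>j\<in>{1..m}. DA j) \<and> (\<forall>u\<in>D. A u = (\<Sum>j=1..m. AA j u))"

text \<open>
  \<open>B A\<^sup>-\<^sup>1\<close> for \<open>A\<close> with domain \<open>D\<close>. A self-adjoint operator with a positive lower bound maps its
  domain bijectively onto the whole space, so that \<open>inv_into D A\<close> is its inverse.
\<close>

definition comp_inverse :: "('h \<Rightarrow> 'h) \<Rightarrow> 'h set \<Rightarrow> ('h \<Rightarrow> 'h) \<Rightarrow> 'h \<Rightarrow> 'h" where
  "comp_inverse B D A = (\<lambda>x. B (inv_into D A x))"

text \<open>
  \<open>u'\<close> and \<open>u''\<close> are the first and second derivatives of \<open>u\<close> on \<open>[0,T]\<close>, one-sided at the end points.
\<close>

definition cauchy_solution ::
  "real \<Rightarrow> 'h::real_normed_vector set \<Rightarrow> ('h \<Rightarrow> 'h) \<Rightarrow> ('h \<Rightarrow> 'h) \<Rightarrow> (real \<Rightarrow> 'h) \<Rightarrow> 'h \<Rightarrow> 'h \<Rightarrow>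
   (real \<Rightarrow> 'h) \<Rightarrow> (real \<Rightarrow> 'h) \<Rightarrow> (real \<Rightarrow> 'h) \<Rightarrow> bool" where
  "cauchy_solution T D A M f \<phi>0 \<phi>1 u u' u'' \<longleftrightarrow>
     (\<forall>t\<in>{0..T}. (u has_vector_derivative u' t) (at t within {0..T})) \<and>
     (\<forall>t\<in>{0..T}. (u' has_vector_derivative u'' t) (at t within {0..T})) \<and>
     continuous_on {0..T} u'' \<and>
     (\<forall>t\<in>{0..T}. u t \<in> D) \<and>
     continuous_on {0..T} (\<lambda>t. A (u t)) \<and>
     continuous_on {0..T} (\<lambda>t. M (u t)) \<and>
     (\<forall>t\<in>{0..T}. u'' t + A (u t) + M (u t) = f t) \<and>
     u 0 = \<phi>0 \<and> u' 0 = \<phi>1"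

definition splitting_scheme ::
  "nat \<Rightarrow> (nat \<Rightarrow> 'h::real_vector set) \<Rightarrow> (nat \<Rightarrow> 'h \<Rightarrow> 'h) \<Rightarrow> (nat \<Rightarrow> real) \<Rightarrow> ('h \<Rightarrow> 'h) \<Rightarrow>
   (real \<Rightarrow> 'h) \<Rightarrow> 'h \<Rightarrow> 'h \<Rightarrow> nat \<Rightarrow> real \<Rightarrow> (nat \<Rightarrow> 'h) \<Rightarrow> (nat \<Rightarrow> nat \<Rightarrow> 'h) \<Rightarrow> bool" where
  "splitting_scheme m DA AA \<eta> M f \<phi>0 \<phi>1 n \<tau> v y \<longleftrightarrow>
     v 0 = \<phi>0 \<and> v 1 = \<phi>0 + \<tau> *\<^sub>R \<phi>1 \<and>
     (\<forall>k\<in>{1..n-1}.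
        (\<forall>j\<in>{1..m}.
           y j (k + 1) \<in> DA j \<and>
           (\<eta> j / \<tau>\<^sup>2) *\<^sub>R (y j (k + 1) - 2 *\<^sub>R v k + v (k - 1)) + AA j (y j (k + 1))
             = (if j = 1 then f (real k * \<tau>) - M (v k) else 0)) \<and>
        v (k + 1) = (\<Sum>j=1..m. \<eta> j *\<^sub>R y j (k + 1)))"

text \<open>The numbers \<open>a\<^sub>j = \<parallel>A\<^sub>j A\<^sup>-\<^sup>1\<parallel>\<close> are passed as the argument \<open>r\<close>.\<close>

definition c0 :: "nat \<Rightarrow> (nat \<Rightarrow> real) \<Rightarrow> (nat \<Rightarrow> real) \<Rightarrow> real" where
  "c0 m \<eta> r = (\<Sum>j=1..m. \<eta> j powr (-1/2) * r j)"

definition c1 :: "nat \<Rightarrow> (nat \<Rightarrow> real) \<Rightarrow> (nat \<Rightarrow> real) \<Rightarrow> real" where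
  "c1 m \<eta> r = (\<Sum>j=1..m. \<eta> j powr (-3/2) * (r j / \<eta> j + 1))"

definition c4 :: "nat \<Rightarrow> (nat \<Rightarrow> real) \<Rightarrow> (nat \<Rightarrow> real) \<Rightarrow> real" where
  "c4 m \<eta> r = (\<Sum>j=1..m. (1 / \<eta> j) * (r j / \<eta> j + 1))"

definition c5 :: "nat \<Rightarrow> (nat \<Rightarrow> real) \<Rightarrow> (nat \<Rightarrow> real) \<Rightarrow> real" where
  "c5 m \<eta> r = c4 m \<eta> r + c1 m \<eta> r"

definition c6 :: "nat \<Rightarrow> (nat \<Rightarrow> real) \<Rightarrow> (nat \<Rightarrow> real) \<Rightarrow> real" where
  "c6 m \<eta> r = \<eta> 1 powr (-1/2) + real m + c0 m \<eta> r"

definition c7 :: "nat \<Rightarrow> (nat \<Rightarrow> real) \<Rightarrow> (nat \<Rightarrow> real) \<Rightarrow> real" where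
  "c7 m \<eta> r = c4 m \<eta> r + c1 m \<eta> r + c6 m \<eta> r"

definition J :: "real \<Rightarrow> nat \<Rightarrow> real \<Rightarrow> (real \<Rightarrow> 'h::real_normed_vector) \<Rightarrow> real" where
  "J \<tau> i t w = norm (w (real i * \<tau>) - w t)"

definition Theta ::
  "nat \<Rightarrow> (nat \<Rightarrow> real) \<Rightarrow> (nat \<Rightarrow> real) \<Rightarrow> real \<Rightarrow> ('h::real_normed_vector \<Rightarrow> 'h) \<Rightarrow> ('h \<Rightarrow> 'h) \<Rightarrow>
   (real \<Rightarrow> 'h) \<Rightarrow> 'h \<Rightarrow> (real \<Rightarrow> 'h) \<Rightarrow> (real \<Rightarrow> 'h) \<Rightarrow> (nat \<Rightarrow> 'h) \<Rightarrow> real \<Rightarrow> nat \<Rightarrow> real" where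
  "Theta m \<eta> r a A M f \<phi>0 u u'' z \<tau> k =
     \<tau> * (\<Sum>i=1..k. c5 m \<eta> r * J \<tau> i (real (i - 1) * \<tau>) u''
                   + J \<tau> i (real (i + 1) * \<tau>) u''
                   + a * c6 m \<eta> r * J \<tau> i (real (i - 1) * \<tau>) u)
   + \<tau> * (\<Sum>i=1..k. c7 m \<eta> r * J \<tau> i (real (i - 1) * \<tau>) f
                   + J \<tau> i (real (i + 1) * \<tau>) f)
   + (\<Sum>i=1..k. integral {real (i - 1) * \<tau>..real (i + 1) * \<tau>} (\<lambda>t. J \<tau> i t u'')
                + \<tau> * a * norm (z i))
   + \<tau> * (c1 m \<eta> r * norm (A \<phi>0) + c6 m \<eta> r * (norm (f 0) + norm (M \<phi>0)))"

end

theory Submission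
  imports Defs
begin

text \<open>
  With the resolvents \<open>R j = (I + (\<tau>\<^sup>2 / \<eta> j) A\<^sub>j)\<^sup>-\<^sup>1\<close> and their average
  \<open>S = \<Sum>j. \<eta> j R j\<close> the scheme becomes the explicit recursion
  \<open>v (k + 1) = S (2 v k - v (k - 1)) + \<tau>\<^sup>2 R 1 (f (t k) - M (v k))\<close>, where \<open>0 \<le> S \<le> I\<close>.
  Let \<open>U n\<close> be the polynomials in \<open>S\<close> that solve the homogeneous recursion and
  \<open>d n = U n - U (n - 1)\<close>. If \<open>S = cos\<^sup>2 \<theta>\<close>, then \<open>d n = cos\<^sup>n\<^sup>-\<^sup>1 \<theta> cos ((n + 1) \<theta>)\<close>; a quadratic
  energy that decreases in \<open>n\<close> yields \<open>\<parallel>d n\<parallel> \<le> 1\<close>, as well as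
  \<open>\<parallel>(I - S)\<^sup>1\<^sup>/\<^sup>2 U n\<parallel> \<le> 1\<close>, without spectral theory. Because \<open>\<eta> j (I - R j) \<le> I - S\<close>, the latter gives
  \<open>\<parallel>U n (I - R j)\<parallel> \<le> (\<eta> j)\<^sup>-\<^sup>1\<^sup>/\<^sup>2\<close>. The consistency error consists of terms controlled by
  differences of \<open>u''\<close>, \<open>A u\<close> and \<open>f - M u\<close> at neighbouring nodes and of terms
  \<open>(I - R j) x i\<close>, which are only bounded; summation by parts in time turns the latter
  into differences of the \<open>x i\<close> and one initial term.
\<close>

section \<open>Positive self-adjoint operators\<close>

text \<open>A quadratic that vanishes at \<open>t = 0\<close> and never becomes negative has slope
  zero there. This is the first-order condition that makes the difference to a nearest point
  orthogonal to a subspace.\<close>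

lemma quadratic_perturbation_nonneg:
  fixes b c :: real
  assumes nonneg: "\<And>t. 0 \<le> t * t * c - 2 * t * b"
    and c: "c \<ge> 0"
  shows "b = 0"
proof (cases "c = 0")
  case True
  then show ?thesis using nonneg[of 1] nonneg[of "-1"] by simp
next
  case False
  with c have cpos: "c > 0" by simp
  \<comment> \<open>\<open>t = b / c\<close> minimises the quadratic.\<close>
  have "(b / c) * (b / c) * c - 2 * (b / c) * b = - (b * b / c)"
    using cpos by (simp add: field_simps)
  then have "b * b / c \<le> 0" using nonneg[of "b / c"] by linarith
  then have "b * b \<le> 0" using cpos by (simp add: divide_le_0_iff)
  then show ?thesis by (auto simp: mult_le_0_iff)
qed

text \<open>A minimising sequence is Cauchy: the midpoint of two members stays in \<open>V\<close>,
  so the parallelogram identity bounds their distance by the excess of their squared distances to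
  \<open>x\<close> over the infimum.\<close>

lemma closed_subspace_nearest_point:
  fixes V :: "'h::{real_inner, complete_space} set"
  assumes sub: "subspace V" and closed: "closed V"
  obtains v where "v \<in> V" "\<And>w. w \<in> V \<Longrightarrow> norm (x - v) \<le> norm (x - w)"
proof -
  define d where "d = infdist x V"
  have ne: "V \<noteq> {}" using subspace_0[OF sub] by auto
  have d_le: "d \<le> norm (x - w)" if "w \<in> V" for w
    using infdist_le[OF that, of x] by (simp add: d_def dist_norm)
  have d_nonneg: "d \<ge> 0" by (simp add: d_def infdist_nonneg)
  have "\<exists>w\<in>V. norm (x - w) < d + 1 / real (Suc n)" for n
  proof -
    have "(INF w\<in>V. dist x w) < d + 1 / real (Suc n)"
      using ne by (simp add: d_def infdist_def)
    moreover have "bdd_below (dist x ` V)" by (rule bdd_belowI[of _ 0]) auto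
    ultimately have "\<exists>w\<in>V. dist x w < d + 1 / real (Suc n)"
      using cINF_less_iff[OF ne, of "dist x"] by blast
    then show ?thesis by (simp only: dist_norm)
  qed
  then obtain s where sV: "\<And>n. s n \<in> V" and sn: "\<And>n. norm (x - s n) < d + 1 / real (Suc n)"
    by metis
  have s_lim: "(\<lambda>n. norm (x - s n)) \<longlonglongrightarrow> d"
  proof (rule tendsto_sandwich)
    show "\<forall>\<^sub>F n in sequentially. d \<le> norm (x - s n)" using d_le sV by simp
    show "\<forall>\<^sub>F n in sequentially. norm (x - s n) \<le> d + 1 / real (Suc n)"
      using less_imp_le[OF sn] by (rule always_eventually[OF allI])
    show "(\<lambda>n. d + 1 / real (Suc n)) \<longlonglongrightarrow> d"
      using tendsto_add[OF tendsto_const LIMSEQ_Suc[OF lim_1_over_n]] by simp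
  qed simp
  have par: "(norm (s m - s n))\<^sup>2 \<le> 2 * (norm (x - s m))\<^sup>2 + 2 * (norm (x - s n))\<^sup>2 - 4 * d\<^sup>2" for m n
  proof -
    have "(1/2) *\<^sub>R (s m + s n) \<in> V" using sV sub by (simp add: subspace_add subspace_scale)
    then have "d\<^sup>2 \<le> (norm (x - (1/2) *\<^sub>R (s m + s n)))\<^sup>2"
      using d_le d_nonneg by (simp add: power_mono)
    moreover have "(norm (s m - s n))\<^sup>2 = 2 * (norm (x - s m))\<^sup>2 + 2 * (norm (x - s n))\<^sup>2
        - 4 * (norm (x - (1/2) *\<^sub>R (s m + s n)))\<^sup>2"
      by (simp add: power2_norm_eq_inner inner_simps inner_commute algebra_simps)
    ultimately show ?thesis by linarith
  qed
  have "Cauchy s"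
  proof (rule CauchyI)
    fix e :: real assume e: "e > 0"
    have "(\<lambda>n. (norm (x - s n))\<^sup>2) \<longlonglongrightarrow> d\<^sup>2" by (intro tendsto_power s_lim)
    then have "\<forall>\<^sub>F n in sequentially. (norm (x - s n))\<^sup>2 < d\<^sup>2 + e\<^sup>2 / 4"
      by (rule order_tendstoD) (use e in simp)
    then obtain N where N: "\<And>n. n \<ge> N \<Longrightarrow> (norm (x - s n))\<^sup>2 < d\<^sup>2 + e\<^sup>2 / 4"
      by (auto simp: eventually_sequentially)
    have "norm (s m - s n) < e" if "m \<ge> N" "n \<ge> N" for m n
    proof -
      have "(norm (s m - s n))\<^sup>2 < e\<^sup>2" using par[of m n] N[OF that(1)] N[OF that(2)] by linarith
      then show ?thesis using e by (simp add: power2_less_imp_less)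
    qed
    then show "\<exists>N. \<forall>m\<ge>N. \<forall>n\<ge>N. norm (s m - s n) < e" by blast
  qed
  then obtain v where v: "s \<longlonglongrightarrow> v" by (auto simp: Cauchy_convergent_iff convergent_def)
  have "v \<in> V" using closed_sequentially[OF closed, of s v] sV v by simp
  moreover have "norm (x - v) = d"
    by (rule LIMSEQ_unique[OF tendsto_norm[OF tendsto_diff[OF tendsto_const v]] s_lim])
  ultimately show thesis using d_le that by simp
qed

text \<open>The difference between \<open>x\<close> and its nearest point in \<open>V\<close> is
  orthogonal to \<open>V\<close>, hence zero. This later shows that ranges of operators fill the
  whole space.\<close>

lemma closed_subspace_eq_UNIV:
  fixes V :: "'h::{real_inner, complete_space} set"
  assumes sub: "subspace V" and closed: "closed V"
    and orth: "\<And>x. (\<And>w. w \<in> V \<Longrightarrow> w \<bullet> x = 0) \<Longrightarrow> x = 0"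
  shows "V = UNIV"
proof -
  have "x \<in> V" for x
  proof -
    obtain v where v: "v \<in> V" "\<And>w. w \<in> V \<Longrightarrow> norm (x - v) \<le> norm (x - w)"
      using closed_subspace_nearest_point[OF sub closed, of x] by blast
    have "w \<bullet> (x - v) = 0" if w: "w \<in> V" for w
    proof (rule quadratic_perturbation_nonneg)
      fix t :: real
      have "v + t *\<^sub>R w \<in> V" using sub v(1) w by (simp add: subspace_add subspace_scale)
      then have "(norm (x - v))\<^sup>2 \<le> (norm (x - (v + t *\<^sub>R w)))\<^sup>2" using v(2) by (simp add: power_mono)
      then show "0 \<le> t * t * (w \<bullet> w) - 2 * t * (w \<bullet> (x - v))"
        by (simp add: power2_norm_eq_inner inner_simps inner_commute algebra_simps)
    qed simp
    then have "x - v = 0" by (rule orth)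
    then show ?thesis using v(1) by simp
  qed
  then show ?thesis by auto
qed

section \<open>Symmetry, maximality and surjectivity of self-adjoint operators\<close>

text \<open>Equality with the adjoint is turned into two working facts, symmetry and maximality.
  Density of \<open>D\<close> makes the definite description in \<open>adjoint_operator\<close>
  meaningful. Maximality later takes the place of closedness of the graph.\<close>

lemma self_adjoint_operatorD:
  assumes "self_adjoint_operator D A"
  shows self_adjoint_linear: "linear_operator_on D A"
    and self_adjoint_dense: "closure D = UNIV"
    and self_adjoint_symmetric: "u \<in> D \<Longrightarrow> v \<in> D \<Longrightarrow> A u \<bullet> v = u \<bullet> A v"
    and self_adjoint_maximal: "(\<And>u. u \<in> D \<Longrightarrow> A u \<bullet> v = u \<bullet> w) \<Longrightarrow> v \<in> D \<and> A v = w"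
proof -
  show lin: "linear_operator_on D A" and dense: "closure D = UNIV"
    using assms by (auto simp: self_adjoint_operator_def)
  have dom: "adjoint_domain D A = D" and adj: "\<And>v. v \<in> D \<Longrightarrow> adjoint_operator D A v = A v"
    using assms by (auto simp: self_adjoint_operator_def)
  have uniq: "w = w'" if "\<And>u. u \<in> D \<Longrightarrow> u \<bullet> w = u \<bullet> w'" for w w'
  proof -
    \<comment> \<open>The vectors orthogonal to \<open>w - w'\<close> form a closed set containing
      the dense set \<open>D\<close>, so \<open>w - w'\<close> is orthogonal to itself.\<close>
    have "closure D \<subseteq> {u. u \<bullet> (w - w') = 0}"
    proof (rule closure_minimal)
      show "closed {u. u \<bullet> (w - w') = 0}" by (intro closed_Collect_eq continuous_intros)
    qed (use that in \<open>auto simp: inner_simps\<close>)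
    then have "w - w' \<in> {u. u \<bullet> (w - w') = 0}" unfolding dense by (rule subsetD) simp
    then show ?thesis by simp
  qed
  have adjD: "A v = w" if v: "v \<in> D" and w: "\<And>u. u \<in> D \<Longrightarrow> A u \<bullet> v = u \<bullet> w" for v w
  proof -
    have "adjoint_operator D A v = w" unfolding adjoint_operator_def
      by (rule the_equality) (use w uniq in fastforce)+
    then show ?thesis using adj[OF v] by simp
  qed
  show "A u \<bullet> v = u \<bullet> A v" if "u \<in> D" "v \<in> D"
  proof -
    obtain w where w: "\<forall>u\<in>D. A u \<bullet> v = u \<bullet> w"
      using \<open>v \<in> D\<close> dom by (auto simp: adjoint_domain_def)
    then have "A v = w" using adjD[OF \<open>v \<in> D\<close>] by blast
    then show ?thesis using w \<open>u \<in> D\<close> by simp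
  qed
  show "v \<in> D \<and> A v = w" if "\<And>u. u \<in> D \<Longrightarrow> A u \<bullet> v = u \<bullet> w"
  proof -
    have "v \<in> D" using that dom by (auto simp: adjoint_domain_def)
    then show ?thesis using adjD that by blast
  qed
qed

lemma linear_operator_onD:
  assumes "linear_operator_on D A"
  shows linear_operator_on_subspace: "subspace D"
    and linear_operator_on_add: "x \<in> D \<Longrightarrow> y \<in> D \<Longrightarrow> A (x + y) = A x + A y"
    and linear_operator_on_scale: "x \<in> D \<Longrightarrow> A (c *\<^sub>R x) = c *\<^sub>R A x"
    and linear_operator_on_diff: "x \<in> D \<Longrightarrow> y \<in> D \<Longrightarrow> A (x - y) = A x - A y"
proof -
  show "subspace D" and add: "\<And>x y. x \<in> D \<Longrightarrow> y \<in> D \<Longrightarrow> A (x + y) = A x + A y"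
    and scale: "\<And>c x. x \<in> D \<Longrightarrow> A (c *\<^sub>R x) = c *\<^sub>R A x"
    using assms by (auto simp: linear_operator_on_def)
  then show "x \<in> D \<Longrightarrow> y \<in> D \<Longrightarrow> A (x - y) = A x - A y"
    using add[of x "(-1) *\<^sub>R y"] scale[of y "-1"] subspace_scale[of D y "-1"] by simp
qed

lemma linear_operator_on_inj:
  assumes lin: "linear_operator_on D B" and lower: "\<And>u. u \<in> D \<Longrightarrow> c * norm u \<le> norm (B u)" and "c > 0"
  shows "inj_on B D"
proof (rule inj_onI)
  fix x y assume "x \<in> D" "y \<in> D" "B x = B y"
  then have "c * norm (x - y) \<le> 0"
    using lower[of "x - y"] linear_operator_on_diff[OF lin, of x y]
      subspace_diff[OF linear_operator_on_subspace[OF lin], of x y] by simp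
  then show "x = y" using \<open>c > 0\<close> by (simp add: mult_le_0_iff)
qed

text \<open>The lower bound pulls a convergent sequence of images back to a Cauchy sequence;
  symmetry passes to its limit, and \<open>maximal\<close> puts that limit into \<open>D\<close>, so
  the range is closed. A vector orthogonal to the range lies in the kernel, again by
  \<open>maximal\<close>, and the lower bound makes it zero. The properties of \<open>B\<close> are
  listed separately so that the lemma applies directly to \<open>I + c A\<close>.\<close>

lemma bounded_below_surjective:
  fixes B :: "'h::{real_inner, complete_space} \<Rightarrow> 'h"
  assumes lin: "linear_operator_on D B"
    and sym: "\<And>u v. u \<in> D \<Longrightarrow> v \<in> D \<Longrightarrow> B u \<bullet> v = u \<bullet> B v"
    and maximal: "\<And>v w. (\<And>u. u \<in> D \<Longrightarrow> B u \<bullet> v = u \<bullet> w) \<Longrightarrow> v \<in> D \<and> B v = w"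
    and lower: "\<And>u. u \<in> D \<Longrightarrow> c * norm u \<le> norm (B u)" and c: "c > 0"
  shows "B ` D = UNIV"
proof (rule closed_subspace_eq_UNIV)
  note sub = linear_operator_on_subspace[OF lin]
  show "subspace (B ` D)"
  proof (rule subspaceI)
    have "B 0 = 0" using linear_operator_on_scale[OF lin subspace_0[OF sub], of 0] by simp
    then show "0 \<in> B ` D" using subspace_0[OF sub] by (metis image_eqI)
    show "x + y \<in> B ` D" if "x \<in> B ` D" "y \<in> B ` D" for x y
    proof -
      obtain a b where "a \<in> D" "b \<in> D" "x = B a" "y = B b" using \<open>x \<in> B ` D\<close> \<open>y \<in> B ` D\<close> by blast
      then have "x + y = B (a + b)" "a + b \<in> D"
        using subspace_add[OF sub] by (simp_all add: linear_operator_on_add[OF lin])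
      then show ?thesis by (rule image_eqI)
    qed
    show "k *\<^sub>R x \<in> B ` D" if "x \<in> B ` D" for x k
    proof -
      obtain a where "a \<in> D" "x = B a" using \<open>x \<in> B ` D\<close> by blast
      then have "k *\<^sub>R x = B (k *\<^sub>R a)" "k *\<^sub>R a \<in> D"
        using subspace_scale[OF sub] by (simp_all add: linear_operator_on_scale[OF lin])
      then show ?thesis by (rule image_eqI)
    qed
  qed
  show "closed (B ` D)" unfolding closed_sequential_limits
  proof (intro allI impI, elim conjE)
    fix s y assume "\<forall>n. s n \<in> B ` D" and sy: "s \<longlonglongrightarrow> y"
    then have "\<forall>n. \<exists>x. x \<in> D \<and> s n = B x" by blast
    then obtain x where xD: "\<And>n. x n \<in> D" and s: "\<And>n. s n = B (x n)" by metis
    have "Cauchy x"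
    proof (rule CauchyI)
      fix e :: real assume "e > 0"
      then have "c * e > 0" using c by simp
      then obtain N where N: "\<And>m n. m \<ge> N \<Longrightarrow> n \<ge> N \<Longrightarrow> norm (s m - s n) < c * e"
        using CauchyD[OF LIMSEQ_imp_Cauchy[OF sy]] by blast
      have "norm (x m - x n) < e" if "m \<ge> N" "n \<ge> N" for m n
      proof -
        have "c * norm (x m - x n) \<le> norm (s m - s n)"
          using lower[of "x m - x n"] xD subspace_diff[OF sub] linear_operator_on_diff[OF lin] s by simp
        then have "c * norm (x m - x n) < c * e" using N[OF that] by simp
        then show ?thesis using c by simp
      qed
      then show "\<exists>N. \<forall>m\<ge>N. \<forall>n\<ge>N. norm (x m - x n) < e" by blast
    qed
    then obtain l where l: "x \<longlonglongrightarrow> l" by (auto simp: Cauchy_convergent_iff convergent_def)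
    have "B u \<bullet> l = u \<bullet> y" if "u \<in> D" for u
    proof (rule LIMSEQ_unique)
      show "(\<lambda>n. B u \<bullet> x n) \<longlonglongrightarrow> B u \<bullet> l" by (intro tendsto_intros l)
      have "(\<lambda>n. u \<bullet> s n) \<longlonglongrightarrow> u \<bullet> y" by (intro tendsto_intros sy)
      then show "(\<lambda>n. B u \<bullet> x n) \<longlonglongrightarrow> u \<bullet> y" using sym[OF that xD] s by simp
    qed
    then show "y \<in> B ` D" using maximal by blast
  qed
  show "x = 0" if "\<And>w. w \<in> B ` D \<Longrightarrow> w \<bullet> x = 0" for x
  proof -
    have "x \<in> D \<and> B x = 0" using that by (intro maximal) simp
    then show ?thesis using lower[of x] c by (simp add: mult_le_0_iff)
  qed
qed

lemma operator_bounded_below_norm: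
  assumes "operator_bounded_below D A \<alpha>" "u \<in> D"
  shows "\<alpha> * norm u \<le> norm (A u)"
proof (cases "u = 0")
  case False
  have "\<alpha> * (norm u)\<^sup>2 \<le> A u \<bullet> u" using assms by (auto simp: operator_bounded_below_def)
  also have "\<dots> \<le> norm (A u) * norm u" by (rule norm_cauchy_schwarz)
  finally show ?thesis using False by (simp add: power2_eq_square)
qed simp

lemma positive_self_adjoint_bij:
  fixes A :: "'h::{real_inner, complete_space} \<Rightarrow> 'h"
  assumes "self_adjoint_operator D A" "operator_bounded_below D A \<alpha>" "\<alpha> > 0"
  shows "bij_betw A D UNIV"
  unfolding bij_betw_def
proof
  show "inj_on A D"
    using linear_operator_on_inj self_adjoint_linear[OF assms(1)]
      operator_bounded_below_norm[OF assms(2)] assms(3) by blast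
  show "A ` D = UNIV"
    by (rule bounded_below_surjective[OF self_adjoint_linear[OF assms(1)]
        self_adjoint_symmetric[OF assms(1)] self_adjoint_maximal[OF assms(1)]
        operator_bounded_below_norm[OF assms(2)] assms(3)])
qed

section \<open>Propagators of the damped recursion\<close>

locale positive_contraction =
  fixes S :: "'h::real_inner \<Rightarrow> 'h"
  assumes linear: "linear S"
    and sym: "S x \<bullet> y = x \<bullet> S y"
    and nonneg: "0 \<le> S x \<bullet> x"
    and le_id: "S x \<bullet> x \<le> x \<bullet> x"
begin

lemma add: "S (x + y) = S x + S y"
  and diff: "S (x - y) = S x - S y"
  and scale: "S (c *\<^sub>R x) = c *\<^sub>R S x"
  using linear by (simp_all add: linear_add linear_diff linear_scale)

lemma sum: "S (\<Sum>i\<in>I. g i) = (\<Sum>i\<in>I. S (g i))"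
  by (rule linear_sum[OF linear])

text \<open>Since \<open>S (I - S)^2 \<ge> 0\<close>, one has \<open>2 S^2 - S^3 \<le> S\<close>;
  then \<open>S^3 \<le> S^2\<close> gives \<open>S^2 \<le> S\<close> without a square root of
  \<open>S\<close>.\<close>

lemma square_le: "S x \<bullet> S x \<le> S x \<bullet> x"
proof -
  have "S (S x) \<bullet> S x \<le> S x \<bullet> S x" by (rule le_id)
  moreover have "0 \<le> S (x - S x) \<bullet> (x - S x)" by (rule nonneg)
  moreover have "S (x - S x) \<bullet> (x - S x) = S x \<bullet> x - 2 * (S x \<bullet> S x) + S (S x) \<bullet> S x"
    by (simp add: diff inner_simps sym[of "S x" x])
  ultimately show ?thesis by linarith
qed

lemma norm_contract: "norm (S x) \<le> norm x"
proof -
  have "S x \<bullet> S x \<le> x \<bullet> x" using square_le le_id order_trans by blast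
  then show ?thesis by (simp add: norm_le)
qed

text \<open>\<open>(2 S - I)^2 = I - 4 (S - S^2)\<close>, and \<open>S^2 \<le> S\<close>.\<close>

lemma norm_reflection_le: "norm (2 *\<^sub>R S x - x) \<le> norm x"
proof -
  have "(2 *\<^sub>R S x - x) \<bullet> (2 *\<^sub>R S x - x) = 4 * (S x \<bullet> S x) - 4 * (S x \<bullet> x) + x \<bullet> x"
    by (simp add: inner_simps inner_commute)
  then show ?thesis using square_le[of x] by (simp add: norm_le)
qed

end

text \<open>Because \<open>2 U n - U (n - 1) = U n + d n\<close>, carrying the pair
  \<open>(U n, d n)\<close> turns the two-step recursion into a one-step one. The start
  \<open>d 0 = I\<close> encodes \<open>U (-1) = 0\<close>.\<close>

fun propagator increment_propagator :: "('h::real_vector \<Rightarrow> 'h) \<Rightarrow> nat \<Rightarrow> 'h \<Rightarrow> 'h" where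
  "propagator S 0 x = x"
| "propagator S (Suc n) x = S (propagator S n x + increment_propagator S n x)"
| "increment_propagator S 0 x = x"
| "increment_propagator S (Suc n) x = S (propagator S n x + increment_propagator S n x) - propagator S n x"

context positive_contraction
begin

abbreviation "U \<equiv> propagator S"
abbreviation "d \<equiv> increment_propagator S"

section \<open>The decreasing quadratic energy\<close>

text \<open>The recursion is an implicit wave equation with stiffness \<open>S^-1 - I\<close>. For
  \<open>p = d (n + 1) x\<close> and \<open>S q = U (n + 1) x\<close> this is kinetic plus potential
  energy, \<open>p \<bullet> p + (S^-1 - I) (S q) \<bullet> S q\<close>; expressing it through
  \<open>q\<close> avoids inverting \<open>S\<close>.\<close>

definition energy :: "'h \<Rightarrow> 'h \<Rightarrow> real" where
  "energy p q = p \<bullet> p + S q \<bullet> q - S q \<bullet> S q"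

text \<open>The arguments on the left are the pair that the recursion produces from
  \<open>(p, q)\<close>. The energy lost is
  \<open>(p - S p) \<bullet> p + S (q - S q) \<bullet> (q - S q)\<close>, a sum of two nonnegative
  forms.\<close>

lemma energy_step: "energy (S p - S q + S (S q)) (p + S q) \<le> energy p q"
proof -
  have "energy (S p - S q + S (S q)) (p + S q) = S p \<bullet> p + S q \<bullet> S q - S (S q) \<bullet> S q"
    by (simp add: energy_def add inner_simps inner_commute sym[of p "S q"])
  moreover have "0 \<le> S (q - S q) \<bullet> (q - S q)" by (rule nonneg)
  moreover have "S (q - S q) \<bullet> (q - S q) = S q \<bullet> q - 2 * (S q \<bullet> S q) + S (S q) \<bullet> S q"
    by (simp add: diff inner_simps sym[of "S q" q])
  ultimately show ?thesis using le_id[of p] by (simp add: energy_def)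
qed

lemma energy_dominates_norm: "p \<bullet> p \<le> energy p q"
  using square_le[of q] by (simp add: energy_def)

lemma energy_dominates_defect: "(S q - S (S q)) \<bullet> S q \<le> energy p q"
proof -
  have "0 \<le> S (q - S q) \<bullet> (q - S q)" by (rule nonneg)
  moreover have "S (q - S q) \<bullet> (q - S q) = S q \<bullet> q - 2 * (S q \<bullet> S q) + S (S q) \<bullet> S q"
    by (simp add: diff inner_simps sym[of "S q" q])
  ultimately show ?thesis by (simp add: energy_def inner_simps add_increasing)
qed

text \<open>The difference of the two sides is a complete square in the form of \<open>S\<close>,
  taken at \<open>p - q + S q\<close>. With \<open>p\<close> and \<open>S q\<close> as increment and
  value at one index, it controls \<open>U n + d n\<close>.\<close>

lemma energy_dominates_defect_next: "(p + S q - S (p + S q)) \<bullet> (p + S q) \<le> energy p q"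
proof -
  have "0 \<le> S (p - q + S q) \<bullet> (p - q + S q)" by (rule nonneg)
  moreover have "q \<bullet> S p = p \<bullet> S q" "q \<bullet> S (S q) = S q \<bullet> S q"
    using sym[of p q] sym[of q "S q"] by (simp_all add: inner_commute)
  then have "energy p q - (p + S q - S (p + S q)) \<bullet> (p + S q) = S (p - q + S q) \<bullet> (p - q + S q)"
    by (simp add: energy_def add diff inner_simps inner_commute)
  ultimately show ?thesis by linarith
qed

lemma energy_propagator: "energy (d (Suc n) x) (U n x + d n x) \<le> x \<bullet> x"
proof (induction n)
  case 0
  \<comment> \<open>Equality holds at the start: the vectors are \<open>2 S x - x\<close> and
    \<open>2 x\<close>, and \<open>(2 S - I)^2 + 4 S - 4 S^2 = I\<close>.\<close>
  show ?case by (simp add: energy_def add inner_simps inner_commute)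
next
  case (Suc n)
  define p q where "p = d (Suc n) x" and "q = U n x + d n x"
  have U: "U (Suc n) x = S q" by (simp add: q_def)
  have "U (Suc n) x + d (Suc n) x = p + S q" unfolding U by (simp add: p_def)
  moreover have "d (Suc (Suc n)) x = S (p + S q) - S q"
    unfolding increment_propagator.simps(2)[of S "Suc n"] U by (simp add: p_def add.commute)
  moreover have "S (p + S q) - S q = S p - S q + S (S q)" by (simp add: add)
  ultimately have "energy (d (Suc (Suc n)) x) (U (Suc n) x + d (Suc n) x) \<le> energy p q"
    using energy_step[of p q] by (simp only:)
  also have "energy p q \<le> x \<bullet> x" using Suc.IH by (simp only: p_def q_def)
  finally show ?case .
qed

lemma increment_propagator_norm_le: "norm (d n x) \<le> norm x"
proof (cases n)
  case (Suc n')
  then have "d n x \<bullet> d n x \<le> x \<bullet> x"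
    using energy_dominates_norm energy_propagator order_trans by blast
  then show ?thesis by (simp add: norm_le)
qed simp

lemma propagator_defect: "(U n x - S (U n x)) \<bullet> U n x \<le> x \<bullet> x"
proof (cases n)
  case 0
  then show ?thesis using nonneg[of x] by (simp add: inner_simps)
next
  case (Suc n')
  then have "U n x = S (U n' x + d n' x)" by simp
  then show ?thesis using order_trans[OF energy_dominates_defect energy_propagator] by metis
qed

text \<open>At \<open>n = 0\<close> the left side would be \<open>4 (x - S x) \<bullet> x\<close>,
  which can exceed \<open>x \<bullet> x\<close>.\<close>

lemma sum_propagator_defect:
  assumes "n > 0"
  shows "(U n x + d n x - S (U n x + d n x)) \<bullet> (U n x + d n x) \<le> x \<bullet> x"
proof -
  obtain n' where n: "n = Suc n'" using assms gr0_conv_Suc by blast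
  have "U n x + d n x = d (Suc n') x + S (U n' x + d n' x)" by (simp add: n)
  then show ?thesis
    using order_trans[OF energy_dominates_defect_next energy_propagator] by metis
qed

lemma propagator_linear: "linear (U n) \<and> linear (d n)"
proof (induction n)
  case 0
  have "U 0 = (\<lambda>x. x)" "d 0 = (\<lambda>x. x)" by auto
  then show ?case by (simp add: linear_iff)
next
  case (Suc n)
  then have "linear (\<lambda>x. S (U n x + d n x))"
    by (intro linear_compose[OF linear_compose_add linear, unfolded comp_def]) auto
  moreover have "U (Suc n) = (\<lambda>x. S (U n x + d n x))" "d (Suc n) = (\<lambda>x. S (U n x + d n x) - U n x)"
    by auto
  ultimately show ?case using Suc by (auto intro: linear_compose_sub)
qed

lemmas propagator_lin = propagator_linear[THEN conjunct1] propagator_linear[THEN conjunct2]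

lemma propagator_commute: "U n (S x) = S (U n x) \<and> d n (S x) = S (d n x)"
  by (induction n) (simp_all add: add diff)

lemma propagator_sym: "U n x \<bullet> y = x \<bullet> U n y \<and> d n x \<bullet> y = x \<bullet> d n y"
proof (induction n arbitrary: x y)
  case (Suc n)
  have "S (U n x + d n x) \<bullet> y = (U n x + d n x) \<bullet> S y" by (rule sym)
  also have "\<dots> = x \<bullet> (U n (S y) + d n (S y))" using Suc by (simp add: inner_add_left inner_add_right)
  also have "\<dots> = x \<bullet> S (U n y + d n y)" by (simp add: propagator_commute add)
  finally show ?case using Suc by (simp add: inner_diff_left inner_diff_right)
qed simp

section \<open>Variation of constants, summation by parts and smoothing\<close>

text \<open>Discrete variation of constants. The initial value \<open>x 1\<close> counts as the
  source at index 0, so that initial data and later sources enter through one sum.\<close>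

lemma duhamel:
  assumes x0: "x 0 = 0" and x1: "x 1 = g 0"
    and step: "\<And>i. i < k \<Longrightarrow> x (Suc (Suc i)) = S (2 *\<^sub>R x (Suc i) - x i) + g (Suc i)"
  shows "x (Suc k) = (\<Sum>i\<le>k. U (k - i) (g i)) \<and> x (Suc k) - x k = (\<Sum>i\<le>k. d (k - i) (g i))"
  using step
proof (induction k)
  case 0
  then show ?case using x0 x1 by simp
next
  case (Suc k)
  then have IH: "x (Suc k) = (\<Sum>i\<le>k. U (k - i) (g i))"
      "x (Suc k) - x k = (\<Sum>i\<le>k. d (k - i) (g i))" by auto
  have U: "U (Suc k - i) y = S (U (k - i) y + d (k - i) y)"
    and d: "d (Suc k - i) y = S (U (k - i) y + d (k - i) y) - U (k - i) y" if "i \<le> k" for i y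
    using that by (simp_all add: Suc_diff_le)
  have "2 *\<^sub>R x (Suc k) - x k = x (Suc k) + (x (Suc k) - x k)" by (simp add: scaleR_2)
  then have "2 *\<^sub>R x (Suc k) - x k = (\<Sum>i\<le>k. U (k - i) (g i) + d (k - i) (g i))"
    using IH by (simp add: sum.distrib)
  then have new: "x (Suc (Suc k)) = (\<Sum>i\<le>k. S (U (k - i) (g i) + d (k - i) (g i))) + g (Suc k)"
    using Suc.prems[of k] by (simp add: sum)
  have "x (Suc (Suc k)) = (\<Sum>i\<le>Suc k. U (Suc k - i) (g i))"
    using new U by simp
  moreover have "x (Suc (Suc k)) - x (Suc k) = (\<Sum>i\<le>Suc k. d (Suc k - i) (g i))"
    using new d IH(1) by (simp add: sum_subtractf)
  ultimately show ?case by blast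
qed

text \<open>Summation by parts, since \<open>d n = U n - U (n - 1)\<close>.\<close>

lemma sum_increment_propagator:
  "(\<Sum>i\<le>k. d (k - i) (X (Suc i))) = U k (X 0) + (\<Sum>i\<le>k. U (k - i) (X (Suc i) - X i))"
proof (induction k arbitrary: X)
  case (Suc k)
  have "(\<Sum>i\<le>Suc k. d (Suc k - i) (X (Suc i))) = d (Suc k) (X 1) + (\<Sum>i\<le>k. d (k - i) (X (Suc (Suc i))))"
    unfolding sum.atMost_Suc_shift by simp
  also have "\<dots> = d (Suc k) (X 1) + U k (X 1) + (\<Sum>i\<le>k. U (k - i) (X (Suc (Suc i)) - X (Suc i)))"
    using Suc.IH[of "\<lambda>i. X (Suc i)"] by simp
  also have "d (Suc k) (X 1) + U k (X 1) = U (Suc k) (X 0) + U (Suc k) (X 1 - X 0)"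
    using linear_diff[OF propagator_lin(1), of "Suc k" "X 1" "X 0"] by simp
  also have "U (Suc k) (X 0) + U (Suc k) (X 1 - X 0) + (\<Sum>i\<le>k. U (k - i) (X (Suc (Suc i)) - X (Suc i)))
      = U (Suc k) (X 0) + (\<Sum>i\<le>Suc k. U (Suc k - i) (X (Suc i) - X i))"
    unfolding sum.atMost_Suc_shift by simp
  finally show ?case .
qed (simp add: linear_diff[OF propagator_lin(1)])

text \<open>Duality: with \<open>y = Y (x - R x)\<close> and \<open>w = Y y\<close>, expand
  \<open>0 \<le> (x - \<eta> w) \<bullet> (I - R) (x - \<eta> w)\<close>, using that \<open>y \<bullet> y = w \<bullet> (I - R) x\<close>.\<close>

lemma smoothing_bound:
  assumes R: "positive_contraction R" and "\<eta> > 0"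
    and comp: "\<And>w. \<eta> * ((w - R w) \<bullet> w) \<le> (w - S w) \<bullet> w"
    and Ysym: "\<And>x y. Y x \<bullet> y = x \<bullet> Y y"
    and defect: "\<And>y. (Y y - S (Y y)) \<bullet> Y y \<le> y \<bullet> y"
  shows "norm (Y (x - R x)) \<le> \<eta> powr (-1/2) * norm x"
proof -
  interpret R: positive_contraction R by fact
  define y w where "y = Y (x - R x)" and "w = Y y"
  define e where "e = x - \<eta> *\<^sub>R w"
  have yy: "y \<bullet> y = (x - R x) \<bullet> w" unfolding w_def by (simp add: y_def Ysym)
  have "\<eta> * ((w - R w) \<bullet> w) \<le> y \<bullet> y" using comp[of w] defect[of y] by (simp add: w_def)
  then have ww: "\<eta> * (\<eta> * ((w - R w) \<bullet> w)) \<le> \<eta> * (y \<bullet> y)" using \<open>\<eta> > 0\<close> by simp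
  have pos: "0 \<le> (e - R e) \<bullet> e" using R.le_id[of e] by (simp add: inner_simps)
  have swap: "R w \<bullet> x = R x \<bullet> w" using R.sym[of w x] by (simp add: inner_commute)
  have "(e - R e) \<bullet> e = (x - R x) \<bullet> x - 2 * \<eta> * (y \<bullet> y) + \<eta> * (\<eta> * ((w - R w) \<bullet> w))"
    unfolding yy e_def R.diff R.scale
    by (simp add: inner_simps swap inner_commute[of w x] algebra_simps)
  with pos have "\<eta> * (y \<bullet> y) \<le> x \<bullet> x" using ww R.nonneg[of x] by (simp add: inner_simps)
  then have "y \<bullet> y \<le> (x \<bullet> x) / \<eta>" using \<open>\<eta> > 0\<close> by (simp add: field_simps)
  then have "sqrt (y \<bullet> y) \<le> sqrt (x \<bullet> x) / sqrt \<eta>"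
    using real_sqrt_le_mono by (metis real_sqrt_divide)
  then have "norm y \<le> norm x * (1 / sqrt \<eta>)" by (simp add: norm_eq_sqrt_inner)
  also have "1 / sqrt \<eta> = \<eta> powr (-1/2)"
    using \<open>\<eta> > 0\<close> powr_minus_divide[of \<eta> "1/2"] by (simp add: powr_half_sqrt)
  also have "norm x * \<eta> powr (-1/2) = \<eta> powr (-1/2) * norm x" by (rule mult.commute)
  finally show ?thesis by (simp add: y_def)
qed

end

section \<open>Resolvents and relatively bounded operators\<close>

lemma bounded_linear_inv_into:
  fixes A :: "'h::real_normed_vector \<Rightarrow> 'h"
  assumes lin: "linear_operator_on D A" and bij: "bij_betw A D UNIV"
    and lower: "\<And>u. u \<in> D \<Longrightarrow> \<alpha> * norm u \<le> norm (A u)" and "\<alpha> > 0"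
  shows "bounded_linear (inv_into D A)"
proof -
  define K where "K = inv_into D A"
  have KD: "K x \<in> D" and AK: "A (K x) = x" for x
    using bij by (auto simp: K_def bij_betw_def inv_into_into f_inv_into_f)
  have KA: "u \<in> D \<Longrightarrow> K (A u) = u" for u
    using bij by (auto simp: K_def bij_betw_def)
  note sub = linear_operator_on_subspace[OF lin]
  have "bounded_linear K"
  proof (rule bounded_linear_intro)
    show "K (x + y) = K x + K y" for x y
      using KA[of "K x + K y"] KD subspace_add[OF sub] by (simp add: linear_operator_on_add[OF lin] AK)
    show "K (c *\<^sub>R x) = c *\<^sub>R K x" for c x
      using KA[of "c *\<^sub>R K x"] KD subspace_scale[OF sub] by (simp add: linear_operator_on_scale[OF lin] AK)
    show "norm (K x) \<le> norm x * (1 / \<alpha>)" for x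
      using lower[OF KD, of x] \<open>\<alpha> > 0\<close> by (simp add: AK field_simps)
  qed
  then show ?thesis by (simp add: K_def)
qed

text \<open>Baire category: otherwise the whole space, as a countable union of closed sets without
  interior points, would have empty interior.\<close>

lemma closed_cover_has_interior:
  fixes F :: "nat \<Rightarrow> 'a::complete_space set"
  assumes closed: "\<And>n. closed (F n)" and cover: "(\<Union>n. F n) = UNIV"
  obtains n x e where "e > 0" "ball x e \<subseteq> F n"
proof -
  have "\<exists>n. interior (F n) \<noteq> {}"
  proof (rule ccontr)
    assume "\<nexists>n. interior (F n) \<noteq> {}"
    then have "euclidean interior_of \<Union>(range F) = {}"
      using closed by (intro Baire_category_alt)
        (auto simp: completely_metrizable_space_euclidean)
    then show False using cover by simp
  qed
  then show thesis using that by (metis all_not_in_conv mem_interior)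
qed

text \<open>Closed graph theorem for \<open>B A\<^sup>-\<^sup>1\<close>: the sets
  \<open>{x. \<parallel>B A\<^sup>-\<^sup>1 x\<parallel> \<le> N}\<close> are closed because, by duality, they are given by conditions
  \<open>A\<^sup>-\<^sup>1 x \<bullet> B y \<le> N\<close>.\<close>

lemma bounded_linear_comp_inverse:
  fixes A B :: "'h::{real_inner, complete_space} \<Rightarrow> 'h"
  assumes K: "bounded_linear (inv_into D A)" and KE: "\<And>x. inv_into D A x \<in> E"
    and B: "self_adjoint_operator E B"
  shows "bounded_linear (comp_inverse B D A)"
proof -
  define K where "K = inv_into D A"
  interpret K: bounded_linear K using K by (simp add: K_def)
  define G where "G x = B (K x)" for x
  note lin = self_adjoint_linear[OF B]
  note sub = linear_operator_on_subspace[OF lin]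
  have KE: "K x \<in> E" for x using KE by (simp add: K_def)
  have Gadd: "G (x + y) = G x + G y" for x y
    by (simp add: G_def K.add linear_operator_on_add[OF lin] KE)
  have Gscale: "G (c *\<^sub>R x) = c *\<^sub>R G x" for c x
    by (simp add: G_def K.scaleR linear_operator_on_scale[OF lin] KE)
  have sym: "G x \<bullet> y = K x \<bullet> B y" if "y \<in> E" for x y
    unfolding G_def by (rule self_adjoint_symmetric[OF B KE that])
  define F where "F N = {x. \<forall>y\<in>{y\<in>E. norm y \<le> 1}. K x \<bullet> B y \<le> real N}" for N :: nat
  have "closed (F N)" for N
  proof -
    have "F N = (\<Inter>y\<in>{y\<in>E. norm y \<le> 1}. {x. K x \<bullet> B y \<le> real N})" by (auto simp: F_def)
    moreover have "closed {x. K x \<bullet> B y \<le> real N}" for y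
      by (intro closed_Collect_le continuous_intros K.continuous_on)
    ultimately show ?thesis by auto
  qed
  moreover have "(\<Union>N. F N) = UNIV"
  proof -
    have "x \<in> F (nat \<lceil>norm (G x)\<rceil>)" for x
    proof -
      have "K x \<bullet> B y \<le> norm (G x)" if "y \<in> E" "norm y \<le> 1" for y
      proof -
        have "K x \<bullet> B y \<le> norm (G x) * norm y" using norm_cauchy_schwarz[of "G x" y] sym that by simp
        also have "\<dots> \<le> norm (G x)" using that by (simp add: mult_left_le)
        finally show ?thesis .
      qed
      then show ?thesis unfolding F_def using order_trans[OF _ real_nat_ceiling_ge] by blast
    qed
    then show ?thesis by blast
  qed
  ultimately obtain N x0 e where e: "e > 0" and ball: "ball x0 e \<subseteq> F N"
    by (rule closed_cover_has_interior)
  \<comment> \<open>Recentring at the origin: \<open>G x = G (x0 + x) - G x0\<close>, where the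
    second term is controlled by testing \<open>x0\<close> against \<open>- y\<close>.\<close>
  have small: "G x \<bullet> y \<le> 2 * real N" if x: "norm x < e" and y: "y \<in> E" "norm y \<le> 1" for x y
  proof -
    have "x0 + x \<in> F N" "x0 \<in> F N" using ball x e by (auto simp: dist_norm)
    moreover have my: "- y \<in> E" "norm (- y) \<le> 1" using y subspace_neg[OF sub] by auto
    ultimately have "K (x0 + x) \<bullet> B y \<le> real N" "K x0 \<bullet> B (- y) \<le> real N"
      using y unfolding F_def by blast+
    then have "G (x0 + x) \<bullet> y \<le> real N" "G x0 \<bullet> (- y) \<le> real N" using sym y(1) my(1) by metis+
    then show ?thesis by (simp add: Gadd inner_simps)
  qed
  have bound: "norm (G x) \<le> 2 * real N" if x: "norm x < e" for x
  proof -
    have "y \<in> {y. G x \<bullet> y \<le> 2 * real N * norm y}" if y: "y \<in> E" for y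
    proof (cases "y = 0")
      case False
      have "y /\<^sub>R norm y \<in> E" "norm (y /\<^sub>R norm y) \<le> 1" using y False subspace_scale[OF sub] by auto
      then have "G x \<bullet> (y /\<^sub>R norm y) \<le> 2 * real N" by (rule small[OF x])
      then show ?thesis using False by (simp add: field_simps)
    qed simp
    moreover have "closed {y. G x \<bullet> y \<le> 2 * real N * norm y}"
      by (intro closed_Collect_le continuous_intros)
    \<comment> \<open>The bound was obtained for \<open>y\<close> in \<open>E\<close> only; density
      of \<open>E\<close> admits \<open>y = G x\<close>, which yields the norm.\<close>
    ultimately have "closure E \<subseteq> {y. G x \<bullet> y \<le> 2 * real N * norm y}"
      by (intro closure_minimal subsetI)
    then have "G x \<bullet> G x \<le> 2 * real N * norm (G x)" unfolding self_adjoint_dense[OF B] by blast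
    then show ?thesis
      by (cases "G x = 0") (simp_all add: power2_norm_eq_inner[symmetric] power2_eq_square)
  qed
  have "bounded_linear G"
  proof (rule bounded_linear_intro[OF Gadd Gscale])
    show "norm (G x) \<le> norm x * (4 * real N / e)" for x
    proof (cases "x = 0")
      case True
      then show ?thesis using Gscale[of 0 0] by simp
    next
      case False
      have "norm (G ((e / (2 * norm x)) *\<^sub>R x)) \<le> 2 * real N" using e False by (intro bound) simp
      then show ?thesis using e False by (simp add: Gscale field_simps)
    qed
  qed
  then show ?thesis by (simp add: comp_inverse_def G_def[abs_def] K_def)
qed

section \<open>Resolvents of positive self-adjoint operators\<close>

definition resolvent :: "'h::real_vector set \<Rightarrow> ('h \<Rightarrow> 'h) \<Rightarrow> real \<Rightarrow> 'h \<Rightarrow> 'h" where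
  "resolvent D A c = inv_into D (\<lambda>x. x + c *\<^sub>R A x)"

text \<open>\<open>I + c A\<close> inherits symmetry and maximality from \<open>A\<close>, the
  latter by solving for \<open>A v\<close>, and is bounded below by 1, so its inverse
  \<open>R\<close> is defined everywhere. Testing that lower bound at \<open>R x\<close> gives
  \<open>R^2 \<le> R\<close>, from which both form bounds on \<open>R\<close> follow.\<close>

lemma
  fixes A :: "'h::{real_inner, complete_space} \<Rightarrow> 'h"
  assumes sa: "self_adjoint_operator D A" and below: "operator_bounded_below D A \<alpha>"
    and "\<alpha> > 0" and c: "c > 0"
  shows resolvent_unique: "y \<in> D \<Longrightarrow> resolvent D A c (y + c *\<^sub>R A y) = y"
    and positive_contraction_resolvent: "positive_contraction (resolvent D A c)"
proof -
  define B where "B x = x + c *\<^sub>R A x" for x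
  define R where "R = resolvent D A c"
  note lin = self_adjoint_linear[OF sa]
  note sub = linear_operator_on_subspace[OF lin]
  have A_nonneg: "0 \<le> A u \<bullet> u" if "u \<in> D" for u
    using below that \<open>\<alpha> > 0\<close> unfolding operator_bounded_below_def
    by (meson less_imp_le mult_nonneg_nonneg order_trans zero_le_power2)
  have linB: "linear_operator_on D B"
    using sub by (simp add: linear_operator_on_def B_def algebra_simps
        linear_operator_on_add[OF lin] linear_operator_on_scale[OF lin])
  have symB: "B u \<bullet> v = u \<bullet> B v" if "u \<in> D" "v \<in> D" for u v
    using self_adjoint_symmetric[OF sa that] by (simp add: B_def inner_simps)
  have maxB: "v \<in> D \<and> B v = w" if *: "\<And>u. u \<in> D \<Longrightarrow> B u \<bullet> v = u \<bullet> w" for v w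
  proof -
    have "v \<in> D \<and> A v = (w - v) /\<^sub>R c"
    proof (rule self_adjoint_maximal[OF sa])
      fix u assume "u \<in> D"
      then have "c * (A u \<bullet> v) = u \<bullet> (w - v)" using *[of u] by (simp add: B_def inner_simps)
      then show "A u \<bullet> v = u \<bullet> ((w - v) /\<^sub>R c)"
        using c unfolding inner_scaleR_right by (simp add: field_simps)
    qed
    then show ?thesis using c by (simp add: B_def)
  qed
  have below1: "u \<bullet> u \<le> B u \<bullet> u" if "u \<in> D" for u
    using A_nonneg[OF that] c by (simp add: B_def inner_simps)
  have "operator_bounded_below D B 1"
    unfolding operator_bounded_below_def using below1 by (simp add: power2_norm_eq_inner)
  note lowerB = operator_bounded_below_norm[OF this]
  have inj: "inj_on B D" by (rule linear_operator_on_inj[OF linB lowerB]) simp_all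
  have surj: "B ` D = UNIV" by (rule bounded_below_surjective[OF linB symB maxB lowerB]) simp_all
  have R_def': "R = inv_into D B" by (simp add: R_def resolvent_def B_def[abs_def])
  have RD: "R x \<in> D" and BR: "B (R x) = x" for x
    using surj by (simp_all add: R_def' inv_into_into f_inv_into_f)
  have "bounded_linear R" unfolding R_def'
    by (rule bounded_linear_inv_into[OF linB _ lowerB]) (use inj surj in \<open>auto simp: bij_betw_def\<close>)
  then have "linear R" by (rule bounded_linear.linear)
  have RR: "R x \<bullet> R x \<le> R x \<bullet> x" for x
    using below1[OF RD[of x]] by (simp add: BR inner_commute)
  show "resolvent D A c (y + c *\<^sub>R A y) = y" if "y \<in> D"
    using inv_into_f_f[OF inj that] by (simp add: R_def[symmetric] R_def' B_def)
  have "positive_contraction R"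
  proof (rule positive_contraction.intro)
    show "linear R" by fact
    show "R x \<bullet> y = x \<bullet> R y" for x y
      using symB[OF RD[of x] RD[of y]] by (simp add: BR)
    show "0 \<le> R x \<bullet> x" for x using RR[of x] inner_ge_zero order_trans by blast
    show "R x \<bullet> x \<le> x \<bullet> x" for x
    proof -
      have "0 \<le> (x - R x) \<bullet> (x - R x)" by simp
      then show ?thesis using RR[of x] by (simp add: inner_simps inner_commute)
    qed
  qed
  then show "positive_contraction (resolvent D A c)" by (simp add: R_def)
qed

section \<open>Second differences\<close>

text \<open>The auxiliary \<open>F t\<close> is the second-order Taylor polynomial about
  \<open>t\<close>, evaluated at \<open>s\<close>, with the second derivative frozen at
  \<open>c\<close>. Its derivative \<open>(s - t) (u'' t - c)\<close> involves nothing beyond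
  \<open>u''\<close>, so the mean value inequality against the integral \<open>G\<close>
  suffices.\<close>

lemma one_sided_taylor_bound:
  fixes u u' u'' :: "real \<Rightarrow> 'a::real_normed_vector"
  assumes ab: "a \<le> b"
    and u: "\<And>t. t \<in> {a..b} \<Longrightarrow> (u has_vector_derivative u' t) (at t within {a..b})"
    and u': "\<And>t. t \<in> {a..b} \<Longrightarrow> (u' has_vector_derivative u'' t) (at t within {a..b})"
    and cont: "continuous_on {a..b} u''"
    and s: "s = a \<or> s = b" 
  shows "norm ((u b + (s - b) *\<^sub>R u' b + ((s - b)\<^sup>2 / 2) *\<^sub>R c)
             - (u a + (s - a) *\<^sub>R u' a + ((s - a)\<^sup>2 / 2) *\<^sub>R c))
         \<le> (b - a) * integral {a..b} (\<lambda>t. norm (c - u'' t))"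
proof -
  define F where "F t = u t + (s - t) *\<^sub>R u' t + ((s - t)\<^sup>2 / 2) *\<^sub>R c" for t
  define G where "G t = (b - a) * integral {a..t} (\<lambda>t. norm (c - u'' t))" for t
  have coef: "(t * 4 - s * 4) / 4 = t - s" for t by simp
  have F: "(F has_vector_derivative (s - t) *\<^sub>R (u'' t - c)) (at t within {a..b})" if "t \<in> {a..b}" for t
    unfolding F_def
    by (auto intro!: derivative_eq_intros u[OF that] u'[OF that] simp: algebra_simps coef)
  have "continuous_on {a..b} (\<lambda>t. norm (c - u'' t))" by (intro continuous_intros cont)
  then have G: "(G has_vector_derivative (b - a) * norm (c - u'' t)) (at t within {a..b})" if "t \<in> {a..b}" for t
    unfolding G_def has_real_derivative_iff_has_vector_derivative[symmetric]
    by (intro DERIV_cmult integral_has_real_derivative that)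
  have "norm (F b - F a) \<le> G b - G a"
  proof (cases "a < b")
    case True
    show ?thesis
    proof (rule differentiable_bound_general[OF True])
      show "continuous_on {a..b} F" "continuous_on {a..b} G"
        unfolding continuous_on_eq_continuous_within
        using has_vector_derivative_continuous[OF F] has_vector_derivative_continuous[OF G] by blast+
      fix t assume t: "a < t" "t < b"
      show "(F has_vector_derivative (s - t) *\<^sub>R (u'' t - c)) (at t)"
        "(G has_vector_derivative (b - a) * norm (c - u'' t)) (at t)"
        using F[of t] G[of t] t by (simp_all add: at_within_Icc_at)
      show "norm ((s - t) *\<^sub>R (u'' t - c)) \<le> (b - a) * norm (c - u'' t)"
        using t s by (auto simp: norm_minus_commute intro!: mult_right_mono)
    qed
  next
    case False
    then have "a = b" using ab by simp
    then show ?thesis by simp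
  qed
  also have "G b - G a = (b - a) * integral {a..b} (\<lambda>t. norm (c - u'' t))" by (simp add: G_def)
  finally show ?thesis by (simp add: F_def)
qed

text \<open>The Taylor bound is applied on each side of \<open>p\<close>, with \<open>s\<close> the
  outer end point and \<open>c = u'' p\<close>; the terms in \<open>u' p\<close> cancel in the
  sum.\<close>

lemma second_difference_bound:
  fixes u u' u'' :: "real \<Rightarrow> 'a::real_normed_vector"
  assumes h: "h \<ge> 0"
    and u: "\<And>t. t \<in> {p - h..p + h} \<Longrightarrow> (u has_vector_derivative u' t) (at t within {p - h..p + h})"
    and u': "\<And>t. t \<in> {p - h..p + h} \<Longrightarrow> (u' has_vector_derivative u'' t) (at t within {p - h..p + h})"
    and cont: "continuous_on {p - h..p + h} u''"
  shows "norm (u (p + h) - 2 *\<^sub>R u p + u (p - h) - h\<^sup>2 *\<^sub>R u'' p)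
         \<le> h * integral {p - h..p + h} (\<lambda>t. norm (u'' p - u'' t))"
proof -
  define g where "g t = norm (u'' p - u'' t)" for t
  have left: "{p - h..p} \<subseteq> {p - h..p + h}" and right: "{p..p + h} \<subseteq> {p - h..p + h}" using h by auto
  have "norm ((u p + ((p - h) - p) *\<^sub>R u' p + (((p - h) - p)\<^sup>2 / 2) *\<^sub>R u'' p)
             - (u (p - h) + ((p - h) - (p - h)) *\<^sub>R u' (p - h) + (((p - h) - (p - h))\<^sup>2 / 2) *\<^sub>R u'' p))
         \<le> (p - (p - h)) * integral {p - h..p} g"
    unfolding g_def using left h
    by (intro one_sided_taylor_bound[of _ _ u u' u'']
        has_vector_derivative_within_subset[OF u left] has_vector_derivative_within_subset[OF u' left]
        continuous_on_subset[OF cont]) auto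
  then have 1: "norm (u p - h *\<^sub>R u' p + (h\<^sup>2 / 2) *\<^sub>R u'' p - u (p - h)) \<le> h * integral {p - h..p} g"
    by simp
  have "norm ((u (p + h) + ((p + h) - (p + h)) *\<^sub>R u' (p + h) + (((p + h) - (p + h))\<^sup>2 / 2) *\<^sub>R u'' p)
             - (u p + ((p + h) - p) *\<^sub>R u' p + (((p + h) - p)\<^sup>2 / 2) *\<^sub>R u'' p))
         \<le> ((p + h) - p) * integral {p..p + h} g"
    unfolding g_def using right h
    by (intro one_sided_taylor_bound[of _ _ u u' u'']
        has_vector_derivative_within_subset[OF u right] has_vector_derivative_within_subset[OF u' right]
        continuous_on_subset[OF cont]) auto
  then have 2: "norm (u (p + h) - (u p + h *\<^sub>R u' p + (h\<^sup>2 / 2) *\<^sub>R u'' p)) \<le> h * integral {p..p + h} g"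
    by simp
  have "h\<^sup>2 *\<^sub>R u'' p = (h\<^sup>2 / 2) *\<^sub>R u'' p + (h\<^sup>2 / 2) *\<^sub>R u'' p"
    by (simp flip: scaleR_add_left)
  then have "u (p + h) - 2 *\<^sub>R u p + u (p - h) - h\<^sup>2 *\<^sub>R u'' p
      = (u (p + h) - (u p + h *\<^sub>R u' p + (h\<^sup>2 / 2) *\<^sub>R u'' p))
        - (u p - h *\<^sub>R u' p + (h\<^sup>2 / 2) *\<^sub>R u'' p - u (p - h))"
    by (simp add: scaleR_2)
  then have "norm (u (p + h) - 2 *\<^sub>R u p + u (p - h) - h\<^sup>2 *\<^sub>R u'' p)
      \<le> h * (integral {p - h..p} g + integral {p..p + h} g)"
    using norm_triangle_ineq4 1 2 by (smt (verit) distrib_left)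
  also have "integral {p - h..p} g + integral {p..p + h} g = integral {p - h..p + h} g"
    using h by (intro Henstock_Kurzweil_Integration.integral_combine integrable_continuous_interval)
      (auto simp: g_def intro!: continuous_intros cont)
  finally show ?thesis by (simp add: g_def[abs_def])
qed

section \<open>Averages of resolvents\<close>

lemma norm_smoothing_sum_le:
  fixes g :: "nat \<Rightarrow> 'h::real_normed_vector"
  assumes "\<And>j. j \<in> {1..m} \<Longrightarrow> norm (h j) \<le> \<eta> j powr (-1/2) * norm (g j)"
    and "\<And>j. j \<in> {1..m} \<Longrightarrow> norm (g j) \<le> r j * N"
  shows "norm (\<Sum>j=1..m. h j) \<le> c0 m \<eta> r * N"
proof -
  have "norm (h j) \<le> \<eta> j powr (-1/2) * r j * N" if "j \<in> {1..m}" for j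
  proof -
    have "norm (h j) \<le> \<eta> j powr (-1/2) * norm (g j)" by (rule assms(1)[OF that])
    also have "\<dots> \<le> \<eta> j powr (-1/2) * (r j * N)" by (intro mult_left_mono assms(2)[OF that]) simp
    finally show ?thesis by (simp add: mult.assoc)
  qed
  then have "norm (\<Sum>j=1..m. h j) \<le> (\<Sum>j=1..m. \<eta> j powr (-1/2) * r j * N)" by (rule sum_norm_le)
  then show ?thesis by (simp add: c0_def sum_distrib_right)
qed

locale averaged_contractions =
  fixes m :: nat and \<eta> :: "nat \<Rightarrow> real" and R :: "nat \<Rightarrow> 'h::real_inner \<Rightarrow> 'h"
  assumes contraction: "j \<in> {1..m} \<Longrightarrow> positive_contraction (R j)"
    and weight_pos: "j \<in> {1..m} \<Longrightarrow> 0 < \<eta> j"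
    and weight_le_1: "j \<in> {1..m} \<Longrightarrow> \<eta> j \<le> 1"
    and weight_sum: "(\<Sum>j=1..m. \<eta> j) = 1"
begin

definition S :: "'h \<Rightarrow> 'h" where
  "S x = (\<Sum>j=1..m. \<eta> j *\<^sub>R R j x)"

lemma defect_eq: "x - S x = (\<Sum>j=1..m. \<eta> j *\<^sub>R (x - R j x))"
  by (simp add: S_def scaleR_diff_right sum_subtractf weight_sum flip: scaleR_sum_left del: One_nat_def)

sublocale positive_contraction S
proof (rule positive_contraction.intro)
  note pc = positive_contraction.sym[OF contraction] positive_contraction.nonneg[OF contraction]
    positive_contraction.le_id[OF contraction] positive_contraction.linear[OF contraction]
  show "linear S"
    unfolding S_def[abs_def] by (intro linear_compose_sum ballI linear_compose_scale_right pc)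
  show "S x \<bullet> y = x \<bullet> S y" for x y
    unfolding S_def inner_sum_left inner_sum_right by (intro sum.cong refl) (simp add: pc(1))
  show "0 \<le> S x \<bullet> x" for x
    unfolding S_def inner_sum_left by (intro sum_nonneg) (simp add: pc(2) weight_pos less_imp_le)
  have "0 \<le> (x - S x) \<bullet> x" for x
    unfolding defect_eq inner_sum_left
    by (intro sum_nonneg) (simp add: inner_diff_left pc(3) weight_pos less_imp_le)
  then show "S x \<bullet> x \<le> x \<bullet> x" for x by (simp add: inner_diff_left)
qed

text \<open>By \<open>defect_eq\<close> the right side is a sum of nonnegative terms; the left side
  is one of them.\<close>

lemma weighted_defect_le:
  assumes "j \<in> {1..m}"
  shows "\<eta> j * ((w - R j w) \<bullet> w) \<le> (w - S w) \<bullet> w"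
proof -
  have "\<eta> j * ((w - R j w) \<bullet> w) \<le> (\<Sum>i=1..m. \<eta> i * ((w - R i w) \<bullet> w))"
    using assms weight_pos positive_contraction.le_id[OF contraction]
    by (intro member_le_sum) (auto simp: inner_diff_left less_imp_le)
  then show ?thesis by (simp add: defect_eq inner_sum_left)
qed

lemma propagator_smoothing:
  assumes "j \<in> {1..m}"
  shows "norm (U n (x - R j x)) \<le> \<eta> j powr (-1/2) * norm x"
  by (rule smoothing_bound[OF contraction[OF assms] weight_pos[OF assms] weighted_defect_le[OF assms]])
    (simp_all add: propagator_sym propagator_defect)

lemma sum_propagator_smoothing:
  assumes "j \<in> {1..m}" "n > 0"
  shows "norm (U n (x - R j x) + d n (x - R j x)) \<le> \<eta> j powr (-1/2) * norm x"
proof (rule smoothing_bound[OF contraction[OF assms(1)] weight_pos[OF assms(1)]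
      weighted_defect_le[OF assms(1)], where Y = "\<lambda>y. U n y + d n y"])
  show "(U n x + d n x) \<bullet> y = x \<bullet> (U n y + d n y)" for x y
    by (simp add: inner_add_left inner_add_right propagator_sym)
qed (rule sum_propagator_defect[OF assms(2)])

lemma weight_powr_ge_1:
  assumes "j \<in> {1..m}" "s \<le> 0"
  shows "1 \<le> \<eta> j powr s"
  using assms weight_pos[OF assms(1)] weight_le_1[OF assms(1)] powr_mono2'[of s "\<eta> j" 1] by simp

text \<open>The case \<open>n = 0\<close> has to be treated separately: there \<open>U n + d n\<close> is twice the identity,
  and \<open>2 R j - I\<close> is a contraction.\<close>

lemma kernel_bound:
  assumes sum_g: "(\<Sum>j=1..m. g j) = x" and g: "\<And>j. j \<in> {1..m} \<Longrightarrow> norm (g j) \<le> r j * norm x"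
  shows "norm (U n ((\<Sum>j=1..m. R j (g j)) - x) + d n (\<Sum>j=1..m. R j (g j))) \<le> (1 + c0 m \<eta> r) * norm x"
proof (cases "n = 0")
  case True
  have "norm (\<Sum>j=1..m. 2 *\<^sub>R R j (g j) - g j) \<le> c0 m \<eta> r * norm x"
  proof (rule norm_smoothing_sum_le[OF _ g])
    fix j assume j: "j \<in> {1..m}"
    have "norm (2 *\<^sub>R R j (g j) - g j) \<le> 1 * norm (g j)"
      using positive_contraction.norm_reflection_le[OF contraction[OF j]] by simp
    also have "\<dots> \<le> \<eta> j powr (-1/2) * norm (g j)"
      by (intro mult_right_mono weight_powr_ge_1 j) auto
    finally show "norm (2 *\<^sub>R R j (g j) - g j) \<le> \<eta> j powr (-1/2) * norm (g j)" .
  qed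
  moreover have "(\<Sum>j=1..m. 2 *\<^sub>R R j (g j) - g j) = ((\<Sum>j=1..m. R j (g j)) - x) + (\<Sum>j=1..m. R j (g j))"
    by (simp add: sum_subtractf sum_g scaleR_2 sum.distrib del: One_nat_def)
  ultimately have "norm (((\<Sum>j=1..m. R j (g j)) - x) + (\<Sum>j=1..m. R j (g j))) \<le> c0 m \<eta> r * norm x" by simp
  then show ?thesis using True by (simp add: distrib_right add_increasing)
next
  case False
  define y where "y j = g j - R j (g j)" for j
  \<comment> \<open>Both occurrences of the resolvent sum leave the same defects \<open>y j\<close>:
    \<open>U n\<close> contributes only \<open>- U n (y j)\<close>, while \<open>d n\<close>
    contributes \<open>d n x - d n (y j)\<close> after summation. This accounts for the 1 and the
    \<open>c0\<close> in the bound.\<close>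
  have Rg: "(\<Sum>j=1..m. R j (g j)) = x - (\<Sum>j=1..m. y j)"
    by (simp add: y_def sum_subtractf sum_g del: One_nat_def)
  have "U n ((\<Sum>j=1..m. R j (g j)) - x) + d n (\<Sum>j=1..m. R j (g j)) = d n x - (\<Sum>j=1..m. U n (y j) + d n (y j))"
    unfolding Rg using propagator_lin[of n]
    by (simp add: linear_diff linear_neg linear_sum sum.distrib)
  moreover have "norm (\<Sum>j=1..m. U n (y j) + d n (y j)) \<le> c0 m \<eta> r * norm x"
    by (rule norm_smoothing_sum_le[OF _ g]) (use sum_propagator_smoothing False in \<open>simp_all add: y_def\<close>)
  moreover have "norm (d n x) \<le> norm x" by (rule increment_propagator_norm_le)
  ultimately show ?thesis
    using norm_triangle_ineq4[of "d n x" "\<Sum>j=1..m. U n (y j) + d n (y j)"] by (simp add: distrib_right)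
qed

text \<open>The residual splits into \<open>X (Suc i) + P (w (Suc i) - w i)\<close>. The second part
  is already a difference in time. The first consists of resolvent defects that are merely bounded;
  summation by parts replaces it by differences of \<open>X\<close> and the initial term
  \<open>U k (X 0)\<close>, and smoothing bounds these.\<close>

lemma residual_sum_bound:
  fixes w g :: "nat \<Rightarrow> 'h"
  assumes lin: "\<And>j. j \<in> {1..m} \<Longrightarrow> linear (G j)"
    and sum_G: "\<And>x. (\<Sum>j=1..m. G j x) = x"
    and norm_G: "\<And>j x. j \<in> {1..m} \<Longrightarrow> norm (G j x) \<le> r j * norm x"
    and l: "l \<in> {1..m}"
  defines "P \<equiv> \<lambda>x. \<Sum>j=1..m. R j (G j x)"
  shows "norm (\<Sum>i\<le>k. d (k - i) (P (2 *\<^sub>R w (Suc i) - w i) - w (Suc i) + (g (Suc i) - R l (g (Suc i)))))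
    \<le> c0 m \<eta> r * norm (w 0) + \<eta> l powr (-1/2) * norm (g 0)
      + (\<Sum>i\<le>k. (1 + c0 m \<eta> r) * norm (w (Suc i) - w i) + \<eta> l powr (-1/2) * norm (g (Suc i) - g i))"
proof -
  have linP: "linear P" unfolding P_def
    using lin positive_contraction.linear[OF contraction]
    by (intro linear_compose_sum ballI) (auto intro: linear_compose[unfolded comp_def])
  have linR: "linear (R l)" by (rule positive_contraction.linear[OF contraction[OF l]])
  define X where "X i = P (w i) - w i + (g i - R l (g i))" for i
  define K where "K i = U (k - i) (P (w (Suc i) - w i) - (w (Suc i) - w i)) + d (k - i) (P (w (Suc i) - w i))" for i
  define L where "L i = U (k - i) ((g (Suc i) - g i) - R l (g (Suc i) - g i))" for i
  have "P (2 *\<^sub>R w (Suc i) - w i) - w (Suc i) + (g (Suc i) - R l (g (Suc i)))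
      = X (Suc i) + P (w (Suc i) - w i)" for i
    by (simp add: X_def linear_diff[OF linP] linear_add[OF linP] scaleR_2)
  then have "(\<Sum>i\<le>k. d (k - i) (P (2 *\<^sub>R w (Suc i) - w i) - w (Suc i) + (g (Suc i) - R l (g (Suc i)))))
      = (\<Sum>i\<le>k. d (k - i) (X (Suc i))) + (\<Sum>i\<le>k. d (k - i) (P (w (Suc i) - w i)))"
    by (simp add: linear_add[OF propagator_lin(2)] sum.distrib)
  \<comment> \<open>The differences of \<open>X\<close> are paired with the leftover
    \<open>P\<close> term under the same index, since \<open>kernel_bound\<close> estimates exactly
    that combination.\<close>
  also have "\<dots> = U k (X 0) + (\<Sum>i\<le>k. U (k - i) (X (Suc i) - X i) + d (k - i) (P (w (Suc i) - w i)))"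
    unfolding sum_increment_propagator sum.distrib by simp
  also have "(\<Sum>i\<le>k. U (k - i) (X (Suc i) - X i) + d (k - i) (P (w (Suc i) - w i))) = (\<Sum>i\<le>k. K i + L i)"
  proof (rule sum.cong[OF refl])
    fix i
    have "X (Suc i) - X i = (P (w (Suc i) - w i) - (w (Suc i) - w i))
        + ((g (Suc i) - g i) - R l (g (Suc i) - g i))"
      by (simp add: X_def linear_diff[OF linP] linear_diff[OF linR])
    then show "U (k - i) (X (Suc i) - X i) + d (k - i) (P (w (Suc i) - w i)) = K i + L i"
      by (simp add: K_def L_def linear_add[OF propagator_lin(1)])
  qed
  finally have eq: "(\<Sum>i\<le>k. d (k - i) (P (2 *\<^sub>R w (Suc i) - w i) - w (Suc i) + (g (Suc i) - R l (g (Suc i)))))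
      = U k (X 0) + (\<Sum>i\<le>k. K i + L i)" .
  have K: "norm (K i) \<le> (1 + c0 m \<eta> r) * norm (w (Suc i) - w i)" for i
    unfolding K_def P_def by (rule kernel_bound[OF sum_G norm_G])
  have L: "norm (L i) \<le> \<eta> l powr (-1/2) * norm (g (Suc i) - g i)" for i
    unfolding L_def by (rule propagator_smoothing[OF l])
  have "norm (\<Sum>i\<le>k. K i + L i)
      \<le> (\<Sum>i\<le>k. (1 + c0 m \<eta> r) * norm (w (Suc i) - w i) + \<eta> l powr (-1/2) * norm (g (Suc i) - g i))"
    by (intro sum_norm_le norm_triangle_le add_mono K L)
  moreover have "norm (U k (X 0)) \<le> c0 m \<eta> r * norm (w 0) + \<eta> l powr (-1/2) * norm (g 0)"
  proof -
    define y where "y j = G j (w 0) - R j (G j (w 0))" for j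
    \<comment> \<open>\<open>sum_G\<close> splits \<open>w 0\<close> into the pieces
      \<open>G j (w 0)\<close>, so that \<open>P (w 0) - w 0\<close> becomes a sum of resolvent
      defects.\<close>
    have "X 0 = (g 0 - R l (g 0)) - (\<Sum>j=1..m. y j)"
      by (simp add: X_def P_def y_def sum_subtractf sum_G del: One_nat_def)
    then have "U k (X 0) = U k (g 0 - R l (g 0)) - (\<Sum>j=1..m. U k (y j))"
      by (simp only: linear_diff[OF propagator_lin(1)] linear_sum[OF propagator_lin(1)])
    moreover have "norm (U k (g 0 - R l (g 0))) \<le> \<eta> l powr (-1/2) * norm (g 0)"
      by (rule propagator_smoothing[OF l])
    moreover have "norm (\<Sum>j=1..m. U k (y j)) \<le> c0 m \<eta> r * norm (w 0)"
      unfolding y_def by (rule norm_smoothing_sum_le[OF propagator_smoothing norm_G])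
    ultimately show ?thesis
      using norm_triangle_ineq4[of "U k (g 0 - R l (g 0))" "\<Sum>j=1..m. U k (y j)"] by simp
  qed
  ultimately show ?thesis
    unfolding eq using norm_triangle_ineq[of "U k (X 0)" "\<Sum>i\<le>k. K i + L i"] by simp
qed

section \<open>Comparison of the constants\<close>

lemma c0_le_c1:
  assumes r: "\<And>j. j \<in> {1..m} \<Longrightarrow> 0 \<le> r j"
  shows "c0 m \<eta> r \<le> c1 m \<eta> r"
  unfolding c0_def c1_def
proof (rule sum_mono)
  fix j assume j: "j \<in> {1..m}"
  have "\<eta> j powr (-1/2) \<le> \<eta> j powr (-3/2)"
    using weight_pos[OF j] weight_le_1[OF j] by (intro powr_mono') auto
  moreover have "r j \<le> r j / \<eta> j + 1"
  proof -
    have "r j * \<eta> j \<le> r j" using weight_le_1[OF j] r[OF j] by (simp add: mult_left_le)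
    then have "r j \<le> r j / \<eta> j" using weight_pos[OF j] by (simp add: field_simps)
    then show ?thesis by simp
  qed
  ultimately show "\<eta> j powr (-1/2) * r j \<le> \<eta> j powr (-3/2) * (r j / \<eta> j + 1)"
    using r[OF j] by (intro mult_mono) auto
qed

lemma one_le_c4:
  assumes r: "\<And>j. j \<in> {1..m} \<Longrightarrow> 0 \<le> r j" and m: "m \<ge> 1"
  shows "1 \<le> c4 m \<eta> r"
proof -
  have nonneg: "0 \<le> (1 / \<eta> j) * (r j / \<eta> j + 1)" if "j \<in> {1..m}" for j
    using weight_pos[OF that] r[OF that] by simp
  have one: "1 \<in> {1..m}" using m by simp
  have "1 * 1 \<le> (1 / \<eta> 1) * (r 1 / \<eta> 1 + 1)"
    using weight_pos[OF one] weight_le_1[OF one] r[OF one] by (intro mult_mono) auto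
  also have "\<dots> \<le> c4 m \<eta> r" unfolding c4_def
    by (rule member_le_sum[OF one]) (use nonneg in auto)
  finally show ?thesis by simp
qed

text \<open>The left sides are the coefficients that the estimate produces for differences of
  \<open>u''\<close>, \<open>u\<close> and \<open>f\<close>. The summand 1 is absorbed by
  \<open>c4\<close> in \<open>c5\<close> and \<open>c7\<close>, and by \<open>m\<close> in
  \<open>c6\<close>.\<close>

lemma constants_le:
  assumes r: "\<And>j. j \<in> {1..m} \<Longrightarrow> 0 \<le> r j" and m: "m \<ge> 1"
  shows "0 \<le> c0 m \<eta> r" "1 + c0 m \<eta> r \<le> c5 m \<eta> r"
    "1 + c0 m \<eta> r + \<eta> 1 powr (-1/2) \<le> c6 m \<eta> r"
    "1 + c0 m \<eta> r + \<eta> 1 powr (-1/2) \<le> c7 m \<eta> r"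
proof -
  show c0: "0 \<le> c0 m \<eta> r" unfolding c0_def using r by (intro sum_nonneg) auto
  show "1 + c0 m \<eta> r \<le> c5 m \<eta> r" using c0_le_c1[of r] one_le_c4[of r] r m by (simp add: c5_def)
  show c6: "1 + c0 m \<eta> r + \<eta> 1 powr (-1/2) \<le> c6 m \<eta> r" using m by (simp add: c6_def)
  show "1 + c0 m \<eta> r + \<eta> 1 powr (-1/2) \<le> c7 m \<eta> r"
    using c6 c0_le_c1[of r] one_le_c4[of r] c0 r m by (simp add: c7_def)
qed

end

section \<open>The error estimate\<close>

text \<open>Shifting the index to start at 0 removes the truncated subtraction \<open>i - 1\<close>
  and aligns the terms with the sums from \<open>duhamel\<close>.\<close>

lemma Theta_eq:
  "Theta m \<eta> r a A M f \<phi>0 u u'' z \<tau> (Suc k) =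
     (\<Sum>i\<le>k. \<tau> * (c5 m \<eta> r * norm (u'' (real (Suc i) * \<tau>) - u'' (real i * \<tau>))
         + norm (u'' (real (Suc i) * \<tau>) - u'' (real (i + 2) * \<tau>))
         + a * c6 m \<eta> r * norm (u (real (Suc i) * \<tau>) - u (real i * \<tau>))
         + c7 m \<eta> r * norm (f (real (Suc i) * \<tau>) - f (real i * \<tau>))
         + norm (f (real (Suc i) * \<tau>) - f (real (i + 2) * \<tau>)))
       + (integral {real i * \<tau>..real (i + 2) * \<tau>} (\<lambda>t. norm (u'' (real (Suc i) * \<tau>) - u'' t))
         + \<tau> * a * norm (z (Suc i))))
     + \<tau> * (c1 m \<eta> r * norm (A \<phi>0) + c6 m \<eta> r * (norm (f 0) + norm (M \<phi>0)))"
  unfolding Theta_def J_def One_nat_def sum.atLeast1_atMost_eq lessThan_Suc_atMost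
  by (simp add: sum_distrib_left sum.distrib distrib_left algebra_simps)

theorem theorem6p1:
  fixes A :: "'h::{real_inner, complete_space} \<Rightarrow> 'h" and D :: "'h set"
    and AA :: "nat \<Rightarrow> 'h \<Rightarrow> 'h" and DA :: "nat \<Rightarrow> 'h set"
    and M :: "'h \<Rightarrow> 'h" and f u u' u'' :: "real \<Rightarrow> 'h"
    and \<phi>0 \<phi>1 :: 'h and v z :: "nat \<Rightarrow> 'h" and y :: "nat \<Rightarrow> nat \<Rightarrow> 'h"
    and \<alpha> a T \<tau> :: real and \<alpha>' \<eta> r :: "nat \<Rightarrow> real" and m n :: nat
  assumes "self_adjoint_operator D A" and "\<alpha> > 0" and "operator_bounded_below D A \<alpha>"
    and "\<And>j. j \<in> {1..m} \<Longrightarrow> self_adjoint_operator (DA j) (AA j)"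
    and "\<And>j. j \<in> {1..m} \<Longrightarrow> \<alpha>' j > 0"
    and "\<And>j. j \<in> {1..m} \<Longrightarrow> operator_bounded_below (DA j) (AA j) (\<alpha>' j)"
    and "operator_sum_eq D A m DA AA"
    and "a > 0" and "\<And>x x'. norm (M x - M x') \<le> a * norm (x - x')"
    and "T > 0" and "continuous_on {0..T} f"
    and "\<And>j. j \<in> {1..m} \<Longrightarrow> 0 < \<eta> j \<and> \<eta> j < 1" and "(\<Sum>j=1..m. \<eta> j) = 1"
    and "n > 1" and "\<tau> = T / real n"
    and "splitting_scheme m DA AA \<eta> M f \<phi>0 \<phi>1 n \<tau> v y"
    and "cauchy_solution T D A M f \<phi>0 \<phi>1 u u' u''" and "\<phi>0 \<in> D"
    and "\<And>k. z k = v k - u (real k * \<tau>)"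
    and "\<And>j. r j = onorm (comp_inverse (AA j) D A)"
  shows "(\<forall>j\<in>{1..m}. bounded_linear (comp_inverse (AA j) D A)) \<and>
    (\<forall>k\<in>{1..n-1}.
       norm ((z (k + 1) - z k) /\<^sub>R \<tau>)
         \<le> norm ((z 1 - z 0) /\<^sub>R \<tau>)
           + (\<tau> * (real k * \<tau>)) powr (-1/2) * norm (z 0)
           + Theta m \<eta> r a A M f \<phi>0 u u'' z \<tau> k)"
proof (intro conjI ballI)
  note saA = assms(1) and belowA = assms(3) and saj = assms(4) and belowj = assms(6)
    and lip = assms(9) and eta = assms(12) and sum_eta = assms(13) and zdef = assms(19) and rdef = assms(20)
  have \<tau>: "\<tau> > 0" using assms(10,14,15) by simp
  have n\<tau>: "real n * \<tau> = T" using assms(14,15) by simp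
  have m: "m \<ge> 1" using sum_eta by (cases m) auto
  then have one: "1 \<in> {1..m}" by simp
  have Dsub: "D \<subseteq> DA j" if "j \<in> {1..m}" for j
    using assms(7) that by (auto simp: operator_sum_eq_def)
  have Asum: "A x = (\<Sum>j=1..m. AA j x)" if "x \<in> D" for x
    using assms(7) that by (auto simp: operator_sum_eq_def)
  note linA = self_adjoint_linear[OF saA]
  note subA = linear_operator_on_subspace[OF linA]
  define K where "K = inv_into D A"
  have bij: "bij_betw A D UNIV" by (rule positive_self_adjoint_bij[OF saA belowA assms(2)])
  have KD: "K x \<in> D" and AK: "A (K x) = x" for x
    using bij by (auto simp: K_def bij_betw_def inv_into_into f_inv_into_f)
  have KA: "x \<in> D \<Longrightarrow> K (A x) = x" for x
    using bij by (auto simp: K_def bij_betw_def)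
  have blK: "bounded_linear (inv_into D A)"
    by (rule bounded_linear_inv_into[OF linA bij operator_bounded_below_norm[OF belowA] assms(2)])
  define G where "G j = comp_inverse (AA j) D A" for j
  have Geq: "G j x = AA j (K x)" for j x by (simp add: G_def comp_inverse_def K_def)
  have GA: "G j (A x) = AA j x" if "x \<in> D" for j x by (simp add: Geq KA[OF that])
  show bl: "bounded_linear (comp_inverse (AA j) D A)" if "j \<in> {1..m}" for j
  proof (rule bounded_linear_comp_inverse[OF blK _ saj[OF that]])
    show "inv_into D A x \<in> DA j" for x using KD[of x] Dsub[OF that] by (auto simp: K_def)
  qed
  have r: "0 \<le> r j" if "j \<in> {1..m}" for j
    unfolding rdef by (rule onorm_pos_le[OF bl[OF that]])
  \<comment> \<open>The parameter arises from multiplying the \<open>j\<close>-th scheme equation by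
    \<open>\<tau>\<^sup>2 / \<eta> j\<close>.\<close>
  define R where "R j = resolvent (DA j) (AA j) (\<tau>\<^sup>2 / \<eta> j)" for j
  have cpos: "\<tau>\<^sup>2 / \<eta> j > 0" if "j \<in> {1..m}" for j using \<tau> eta[OF that] by simp
  interpret averaged_contractions m \<eta> R
  proof (rule averaged_contractions.intro)
    show "positive_contraction (R j)" if "j \<in> {1..m}" for j
      unfolding R_def by (rule positive_contraction_resolvent[OF saj belowj assms(5) cpos]) (rule that)+
  qed (use eta sum_eta in \<open>auto intro: less_imp_le\<close>)
  have R_unique: "R j (x + (\<tau>\<^sup>2 / \<eta> j) *\<^sub>R AA j x) = x" if j: "j \<in> {1..m}" and x: "x \<in> DA j" for j x
    unfolding R_def
    by (rule resolvent_unique[OF saj[OF j] belowj[OF j] assms(5)[OF j] cpos[OF j] x])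
  define P where "P x = (\<Sum>j=1..m. R j (G j x))" for x
  have linG: "linear (G j)" if "j \<in> {1..m}" for j
    using bl[OF that] by (simp add: G_def bounded_linear.linear)
  have sumG: "(\<Sum>j=1..m. G j x) = x" for x
    using Asum[OF KD[of x]] by (simp add: Geq AK)
  have normG: "norm (G j x) \<le> r j * norm x" if "j \<in> {1..m}" for j x
    unfolding rdef G_def by (rule onorm[OF bl[OF that]])
  have Rlin: "linear (R j)" if "j \<in> {1..m}" for j
    by (rule positive_contraction.linear[OF contraction[OF that]])

  define tt where "tt i = real i * \<tau>" for i
  define w where "w i = A (u (tt i))" for i
  define g where "g i = f (tt i) - M (u (tt i))" for i
  \<comment> \<open>Three sources of error: \<open>e\<close> from the second difference,
    \<open>h\<close> from the splitting (scaled by \<open>\<tau>\<^sup>-\<^sup>2\<close>), and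
    \<open>q\<close> from evaluating \<open>M\<close> at \<open>v\<close> instead of
    \<open>u\<close>.\<close>
  define e where "e i = u (tt (i + 2)) - 2 *\<^sub>R u (tt (Suc i)) + u (tt i) - \<tau>\<^sup>2 *\<^sub>R u'' (tt (Suc i))" for i
  define h where "h i = P (2 *\<^sub>R w (Suc i) - w i) - w (Suc i) + (g (Suc i) - R 1 (g (Suc i)))" for i
  define q where "q i = R 1 (M (v (Suc i)) - M (u (tt (Suc i))))" for i
  define I where "I i = integral {tt i..tt (i + 2)} (\<lambda>t. norm (u'' (tt (Suc i)) - u'' t))" for i
  have tt: "tt i \<in> {0..T}" if "i \<le> n" for i
    using that \<tau> n\<tau>[symmetric] by (auto simp: tt_def mult_right_mono)
  note sol = assms(17)[unfolded cauchy_solution_def]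
  have uD: "u t \<in> D" if "t \<in> {0..T}" for t using sol that by blast
  have u''_eq: "u'' (tt i) = g i - w i" if "i \<le> n" for i
  proof -
    have "u'' (tt i) + A (u (tt i)) + M (u (tt i)) = f (tt i)" using sol tt[OF that] by blast
    then show ?thesis by (simp add: g_def w_def algebra_simps)
  qed
  have z0: "z 0 = 0"
    using assms(16) sol by (simp add: zdef splitting_scheme_def)

  \<comment> \<open>Applying \<open>R j\<close> to
    \<open>x + (\<tau>\<^sup>2 / \<eta> j) A\<^sub>j x\<close> shows that \<open>I - R j\<close> is
    \<open>\<tau>\<^sup>2 / \<eta> j\<close> times \<open>R j A\<^sub>j\<close> on \<open>D\<close>;
    the weights in the average cancel the \<open>\<eta> j\<close>.\<close>
  have AS: "x - S x = \<tau>\<^sup>2 *\<^sub>R P (A x)" if x: "x \<in> D" for x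
  proof -
    have "\<eta> j *\<^sub>R (x - R j x) = \<tau>\<^sup>2 *\<^sub>R R j (G j (A x))" if j: "j \<in> {1..m}" for j
    proof -
      have "R j (x + (\<tau>\<^sup>2 / \<eta> j) *\<^sub>R AA j x) = x"
        by (rule R_unique[OF j]) (use Dsub[OF j] x in blast)
      then have "x - R j x = (\<tau>\<^sup>2 / \<eta> j) *\<^sub>R R j (AA j x)"
        by (simp add: linear_add[OF Rlin[OF j]] linear_scale[OF Rlin[OF j]] algebra_simps)
      then show ?thesis using eta[OF j] by (simp add: GA[OF x])
    qed
    then show ?thesis unfolding defect_eq P_def scaleR_sum_right by (rule sum.cong[OF refl])
  qed

  have scheme: "v (Suc (Suc i)) = S (2 *\<^sub>R v (Suc i) - v i) + \<tau>\<^sup>2 *\<^sub>R R 1 (f (tt (Suc i)) - M (v (Suc i)))"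
    if "i + 2 \<le> n" for i
  proof -
    define b F where "b = 2 *\<^sub>R v (Suc i) - v i" and "F = f (tt (Suc i)) - M (v (Suc i))"
    have "Suc i \<in> {1..n-1}" using that by auto
    then have yD: "y j (i + 2) \<in> DA j"
      and yeq: "(\<eta> j / \<tau>\<^sup>2) *\<^sub>R (y j (i + 2) - b) + AA j (y j (i + 2)) = (if j = 1 then F else 0)"
      and vsum: "v (i + 2) = (\<Sum>j=1..m. \<eta> j *\<^sub>R y j (i + 2))"
      if "j \<in> {1..m}" for j
      using assms(16) that unfolding splitting_scheme_def b_def F_def tt_def
      by (force simp: algebra_simps)+
    have "\<eta> j *\<^sub>R y j (i + 2) = \<eta> j *\<^sub>R R j b + (if j = 1 then \<tau>\<^sup>2 *\<^sub>R R 1 F else 0)" if j: "j \<in> {1..m}" for j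
    proof -
      define Y where "Y = y j (i + 2)"
      have "(\<tau>\<^sup>2 / \<eta> j) *\<^sub>R ((\<eta> j / \<tau>\<^sup>2) *\<^sub>R (Y - b) + AA j Y) = (\<tau>\<^sup>2 / \<eta> j) *\<^sub>R (if j = 1 then F else 0)"
        using yeq[OF j] by (simp add: Y_def)
      then have "Y + (\<tau>\<^sup>2 / \<eta> j) *\<^sub>R AA j Y = b + (\<tau>\<^sup>2 / \<eta> j) *\<^sub>R (if j = 1 then F else 0)"
        using eta[OF j] \<tau> by (simp add: scaleR_add_right algebra_simps)
      moreover have "R j (Y + (\<tau>\<^sup>2 / \<eta> j) *\<^sub>R AA j Y) = Y"
        by (rule R_unique[OF j]) (use yD[OF j] in \<open>simp add: Y_def\<close>)
      ultimately have "Y = R j b + (\<tau>\<^sup>2 / \<eta> j) *\<^sub>R R j (if j = 1 then F else 0)"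
        by (simp add: linear_add[OF Rlin[OF j]] linear_scale[OF Rlin[OF j]])
      \<comment> \<open>The factor \<open>\<eta> j\<close> cancels the one in
        \<open>\<tau>\<^sup>2 / \<eta> j\<close>, so the forcing enters through \<open>R 1\<close>
        with no weight left.\<close>
      then have "\<eta> j *\<^sub>R Y = \<eta> j *\<^sub>R R j b + (if j = 1 then \<tau>\<^sup>2 *\<^sub>R R 1 F else 0)"
        using eta[OF j] linear_0[OF Rlin[OF j]] by (auto simp: scaleR_add_right)
      then show ?thesis by (simp only: Y_def)
    qed
    then have "v (i + 2) = (\<Sum>j=1..m. \<eta> j *\<^sub>R R j b + (if j = 1 then \<tau>\<^sup>2 *\<^sub>R R 1 F else 0))"
      unfolding vsum[OF one] by (rule sum.cong[OF refl])
    also have "\<dots> = S b + \<tau>\<^sup>2 *\<^sub>R R 1 F"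
      using one by (simp add: sum.distrib S_def del: One_nat_def)
    finally show ?thesis by (simp add: b_def F_def)
  qed

  have z_step: "z (Suc (Suc i)) = S (2 *\<^sub>R z (Suc i) - z i) - (\<tau>\<^sup>2 *\<^sub>R q i + e i + \<tau>\<^sup>2 *\<^sub>R h i)"
    if i: "i + 2 \<le> n" for i
  proof -
    define b where "b = 2 *\<^sub>R u (tt (Suc i)) - u (tt i)"
    have uu: "u (tt (Suc i)) \<in> D" "u (tt i) \<in> D" using i by (auto intro!: uD tt)
    have bD: "b \<in> D" unfolding b_def using uu subA by (simp add: subspace_diff subspace_scale)
    have "A b = 2 *\<^sub>R w (Suc i) - w i"
      using uu subspace_scale[OF subA] by (simp add: b_def w_def linear_operator_on_diff[OF linA]
          linear_operator_on_scale[OF linA])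
    with AS[OF bD] have "b - S b = \<tau>\<^sup>2 *\<^sub>R P (2 *\<^sub>R w (Suc i) - w i)" by simp
    then have Sb: "S b = b - \<tau>\<^sup>2 *\<^sub>R P (2 *\<^sub>R w (Suc i) - w i)"
      by (metis diff_diff_eq2 add_diff_cancel_left')
    \<comment> \<open>The differential equation replaces \<open>u''\<close> by \<open>g - w\<close>
      here; comparison with \<open>Sb\<close> then leaves exactly \<open>h\<close>.\<close>
    have ue: "u (tt (Suc (Suc i))) = b + \<tau>\<^sup>2 *\<^sub>R (g (Suc i) - w (Suc i)) + e i"
      using i by (simp add: e_def b_def u''_eq)
    have "2 *\<^sub>R z (Suc i) - z i = (2 *\<^sub>R v (Suc i) - v i) - b"
      by (simp add: zdef b_def tt_def scaleR_diff_right)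
    then have Sz: "S (2 *\<^sub>R z (Suc i) - z i) = S (2 *\<^sub>R v (Suc i) - v i) - S b" by (simp add: diff)
    have Rq: "R 1 (f (tt (Suc i)) - M (v (Suc i))) = R 1 (g (Suc i)) - q i"
      unfolding q_def g_def linear_diff[OF Rlin[OF one], symmetric] by simp
    have "z (Suc (Suc i)) = v (Suc (Suc i)) - u (tt (Suc (Suc i)))" by (simp add: zdef tt_def)
    also have "\<dots> = S (2 *\<^sub>R z (Suc i) - z i) - (\<tau>\<^sup>2 *\<^sub>R q i + e i + \<tau>\<^sup>2 *\<^sub>R h i)"
      unfolding scheme[OF i] Rq ue Sz Sb h_def by (simp add: algebra_simps)
    finally show ?thesis .
  qed

  have q: "norm (q i) \<le> a * norm (z (Suc i))" for i
  proof -
    have "norm (q i) \<le> norm (M (v (Suc i)) - M (u (tt (Suc i))))"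
      unfolding q_def by (rule positive_contraction.norm_contract[OF contraction[OF one]])
    also have "\<dots> \<le> a * norm (z (Suc i))" using lip by (simp add: zdef tt_def)
    finally show ?thesis .
  qed
  have e: "norm (e i) \<le> \<tau> * I i" if i: "i + 2 \<le> n" for i
  proof -
    have minus: "tt (Suc i) - \<tau> = tt i" and plus: "tt (Suc i) + \<tau> = tt (i + 2)"
      by (simp_all add: tt_def algebra_simps)
    have sub: "{tt i..tt (i + 2)} \<subseteq> {0..T}" using tt[of i] tt[OF i] i by auto
    have "norm (u (tt (Suc i) + \<tau>) - 2 *\<^sub>R u (tt (Suc i)) + u (tt (Suc i) - \<tau>) - \<tau>\<^sup>2 *\<^sub>R u'' (tt (Suc i)))
       \<le> \<tau> * integral {tt (Suc i) - \<tau>..tt (Suc i) + \<tau>} (\<lambda>t. norm (u'' (tt (Suc i)) - u'' t))"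
    proof (rule second_difference_bound[where u' = u'])
      show "(u has_vector_derivative u' t) (at t within {tt (Suc i) - \<tau>..tt (Suc i) + \<tau>})"
        and "(u' has_vector_derivative u'' t) (at t within {tt (Suc i) - \<tau>..tt (Suc i) + \<tau>})"
        if "t \<in> {tt (Suc i) - \<tau>..tt (Suc i) + \<tau>}" for t
        using that sub sol unfolding minus plus by (blast intro: has_vector_derivative_within_subset)+
      show "continuous_on {tt (Suc i) - \<tau>..tt (Suc i) + \<tau>} u''"
        using sub sol unfolding minus plus by (blast intro: continuous_on_subset)
    qed (use \<tau> in simp)
    then show ?thesis by (simp add: e_def I_def minus plus)
  qed

  fix k assume "k \<in> {1..n-1}"
  then obtain k' where k: "k = Suc k'" and k': "k' + 2 \<le> n"
    using assms(14) by (cases k) auto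
  \<comment> \<open>Since \<open>z 0 = 0\<close>, the value \<open>z 1\<close> is the source at
    index 0 and yields \<open>d k (z 1)\<close>; the error sources follow, shifted by one.\<close>
  define c where "c i = (case i of 0 \<Rightarrow> z 1 | Suc i \<Rightarrow> - (\<tau>\<^sup>2 *\<^sub>R q i + e i + \<tau>\<^sup>2 *\<^sub>R h i))" for i
  have "z (Suc k) - z k = (\<Sum>i\<le>k. d (k - i) (c i))"
    by (rule duhamel[THEN conjunct2]) (use z0 z_step k k' in \<open>simp_all add: c_def\<close>)
  also have "\<dots> = d k (z 1) - ((\<Sum>i\<le>k'. d (k' - i) (\<tau>\<^sup>2 *\<^sub>R q i + e i)) + \<tau>\<^sup>2 *\<^sub>R (\<Sum>i\<le>k'. d (k' - i) (h i)))"
    unfolding k sum.atMost_Suc_shift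
    by (simp add: c_def linear_neg[OF propagator_lin(2)] linear_add[OF propagator_lin(2)]
        linear_diff[OF propagator_lin(2)] linear_scale[OF propagator_lin(2)]
        sum.distrib sum_negf sum_subtractf scaleR_sum_right del: increment_propagator.simps)
  finally have "norm (z (Suc k) - z k) \<le> norm (z 1)
      + norm (\<Sum>i\<le>k'. d (k' - i) (\<tau>\<^sup>2 *\<^sub>R q i + e i)) + \<tau>\<^sup>2 * norm (\<Sum>i\<le>k'. d (k' - i) (h i))"
    using norm_triangle_ineq4[of "d k (z 1)" "(\<Sum>i\<le>k'. d (k' - i) (\<tau>\<^sup>2 *\<^sub>R q i + e i)) + \<tau>\<^sup>2 *\<^sub>R (\<Sum>i\<le>k'. d (k' - i) (h i))"]
      norm_triangle_ineq[of "\<Sum>i\<le>k'. d (k' - i) (\<tau>\<^sup>2 *\<^sub>R q i + e i)" "\<tau>\<^sup>2 *\<^sub>R (\<Sum>i\<le>k'. d (k' - i) (h i))"]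
      increment_propagator_norm_le[of k "z 1"]
    by simp
  moreover have "norm (\<Sum>i\<le>k'. d (k' - i) (\<tau>\<^sup>2 *\<^sub>R q i + e i))
      \<le> (\<Sum>i\<le>k'. \<tau> * (I i + \<tau> * a * norm (z (Suc i))))"
  proof (rule sum_norm_le)
    fix i assume "i \<in> {..k'}"
    then have i: "i + 2 \<le> n" using k' by simp
    have "norm (d (k' - i) (\<tau>\<^sup>2 *\<^sub>R q i + e i)) \<le> norm (\<tau>\<^sup>2 *\<^sub>R q i + e i)"
      by (rule increment_propagator_norm_le)
    also have "\<dots> \<le> \<tau>\<^sup>2 * norm (q i) + norm (e i)"
      using norm_triangle_ineq[of "\<tau>\<^sup>2 *\<^sub>R q i" "e i"] by simp
    also have "\<dots> \<le> \<tau>\<^sup>2 * (a * norm (z (Suc i))) + \<tau> * I i"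
      by (intro add_mono mult_left_mono q e i) simp
    finally show "norm (d (k' - i) (\<tau>\<^sup>2 *\<^sub>R q i + e i)) \<le> \<tau> * (I i + \<tau> * a * norm (z (Suc i)))"
      by (simp add: power2_eq_square algebra_simps)
  qed
  moreover define B where "B = c0 m \<eta> r * norm (w 0) + \<eta> 1 powr (-1/2) * norm (g 0)
      + (\<Sum>i\<le>k'. (1 + c0 m \<eta> r) * norm (w (Suc i) - w i) + \<eta> 1 powr (-1/2) * norm (g (Suc i) - g i))"
  have "norm (\<Sum>i\<le>k'. d (k' - i) (h i)) \<le> B"
    unfolding h_def P_def B_def by (rule residual_sum_bound[OF linG sumG normG one])
  \<comment> \<open>One factor \<open>\<tau>\<close> is set aside for the division in the difference
    quotient.\<close>
  then have "\<tau>\<^sup>2 * norm (\<Sum>i\<le>k'. d (k' - i) (h i)) \<le> \<tau> * (\<tau> * B)"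
    using \<tau> by (simp add: power2_eq_square)
  ultimately have "norm (z (Suc k) - z k) \<le> norm (z 1)
      + \<tau> * ((\<Sum>i\<le>k'. I i + \<tau> * a * norm (z (Suc i))) + \<tau> * B)"
    by (simp add: sum_distrib_left distrib_left)
  then have "norm ((z (Suc k) - z k) /\<^sub>R \<tau>) \<le> norm (z 1) / \<tau>
      + ((\<Sum>i\<le>k'. I i + \<tau> * a * norm (z (Suc i))) + \<tau> * B)"
    using \<tau> unfolding norm_scaleR by (simp add: field_simps)
  moreover have "(\<Sum>i\<le>k'. I i + \<tau> * a * norm (z (Suc i))) + \<tau> * B \<le> Theta m \<eta> r a A M f \<phi>0 u u'' z \<tau> k"
  proof -
    define p where "p = \<eta> 1 powr (-1/2)"
    have p: "p \<ge> 0" by (simp add: p_def)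
    note cs = constants_le[of r, OF r m]
    define E where "E i = c5 m \<eta> r * norm (u'' (tt (Suc i)) - u'' (tt i))
        + a * c6 m \<eta> r * norm (u (tt (Suc i)) - u (tt i))
        + c7 m \<eta> r * norm (f (tt (Suc i)) - f (tt i))" for i
    have diffs: "(1 + c0 m \<eta> r) * norm (w (Suc i) - w i) + p * norm (g (Suc i) - g i) \<le> E i"
      if "i \<le> k'" for i
    proof -
      define Ju Jf Jm where "Ju = norm (u'' (tt (Suc i)) - u'' (tt i))"
        and "Jf = norm (f (tt (Suc i)) - f (tt i))"
        and "Jm = a * norm (u (tt (Suc i)) - u (tt i))"
      have J: "Ju \<ge> 0" "Jf \<ge> 0" "Jm \<ge> 0" using assms(8) by (simp_all add: Ju_def Jf_def Jm_def)
      have "g (Suc i) - g i = (f (tt (Suc i)) - f (tt i)) - (M (u (tt (Suc i))) - M (u (tt i)))"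
        by (simp add: g_def)
      then have g: "norm (g (Suc i) - g i) \<le> Jf + Jm"
        using norm_triangle_ineq4[of "f (tt (Suc i)) - f (tt i)" "M (u (tt (Suc i))) - M (u (tt i))"]
          lip[of "u (tt (Suc i))" "u (tt i)"] by (simp add: Jf_def Jm_def)
      \<comment> \<open>The equation expresses differences of \<open>A u\<close> through those of
        \<open>f\<close>, \<open>M u\<close> and \<open>u''\<close>, so no time regularity of
        \<open>A u\<close> beyond this is used.\<close>
      have "w (Suc i) - w i = (g (Suc i) - g i) - (u'' (tt (Suc i)) - u'' (tt i))"
        using that k' by (simp add: u''_eq)
      then have w: "norm (w (Suc i) - w i) \<le> Jf + Jm + Ju"
        using norm_triangle_ineq4[of "g (Suc i) - g i" "u'' (tt (Suc i)) - u'' (tt i)"] g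
        by (simp add: Ju_def)
      have "(1 + c0 m \<eta> r) * norm (w (Suc i) - w i) + p * norm (g (Suc i) - g i)
          \<le> (1 + c0 m \<eta> r) * (Jf + Jm + Ju) + p * (Jf + Jm)"
        by (intro add_mono mult_left_mono w g p) (use cs(1) in simp)
      also have "\<dots> = (1 + c0 m \<eta> r) * Ju + (1 + c0 m \<eta> r + p) * Jm + (1 + c0 m \<eta> r + p) * Jf"
        by (simp add: algebra_simps)
      also have "\<dots> \<le> c5 m \<eta> r * Ju + c6 m \<eta> r * Jm + c7 m \<eta> r * Jf"
        unfolding p_def by (intro add_mono mult_right_mono cs J)
      finally show ?thesis by (simp add: E_def Ju_def Jf_def Jm_def mult_ac)
    qed
    have init: "c0 m \<eta> r * norm (w 0) + p * norm (g 0)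
        \<le> c1 m \<eta> r * norm (A \<phi>0) + c6 m \<eta> r * (norm (f 0) + norm (M \<phi>0))"
    proof (rule add_mono)
      have u0: "u 0 = \<phi>0" using sol by blast
      then show "c0 m \<eta> r * norm (w 0) \<le> c1 m \<eta> r * norm (A \<phi>0)"
        using c0_le_c1[of r, OF r] by (simp add: w_def tt_def mult_right_mono)
      have "norm (g 0) \<le> norm (f 0) + norm (M \<phi>0)"
        using norm_triangle_ineq4[of "f 0" "M \<phi>0"] by (simp add: g_def tt_def u0)
      moreover have "p \<le> c6 m \<eta> r" using cs(1,3) by (simp add: p_def)
      ultimately show "p * norm (g 0) \<le> c6 m \<eta> r * (norm (f 0) + norm (M \<phi>0))"
        using p by (intro mult_mono) auto
    qed
    have "B \<le> (c1 m \<eta> r * norm (A \<phi>0) + c6 m \<eta> r * (norm (f 0) + norm (M \<phi>0))) + (\<Sum>i\<le>k'. E i)"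
      unfolding B_def p_def[symmetric] by (intro add_mono init sum_mono) (use diffs in auto)
    then have "\<tau> * B \<le> \<tau> * ((c1 m \<eta> r * norm (A \<phi>0) + c6 m \<eta> r * (norm (f 0) + norm (M \<phi>0))) + (\<Sum>i\<le>k'. E i))"
      using \<tau> by (intro mult_left_mono) auto
    then have "\<tau> * B \<le> (\<Sum>i\<le>k'. \<tau> * E i)
        + \<tau> * (c1 m \<eta> r * norm (A \<phi>0) + c6 m \<eta> r * (norm (f 0) + norm (M \<phi>0)))"
      by (simp add: distrib_left sum_distrib_left)
    then have "(\<Sum>i\<le>k'. I i + \<tau> * a * norm (z (Suc i))) + \<tau> * B
        \<le> (\<Sum>i\<le>k'. \<tau> * E i + (I i + \<tau> * a * norm (z (Suc i))))
          + \<tau> * (c1 m \<eta> r * norm (A \<phi>0) + c6 m \<eta> r * (norm (f 0) + norm (M \<phi>0)))"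
      by (simp add: sum.distrib)
    \<comment> \<open>The bracket in \<open>Theta_eq\<close> equals \<open>E i\<close> plus norms of
      differences to the following node.\<close>
    also have "\<dots> \<le> Theta m \<eta> r a A M f \<phi>0 u u'' z \<tau> k"
      unfolding k Theta_eq tt_def[symmetric] I_def[symmetric]
      using \<tau> by (intro add_mono order_refl sum_mono mult_left_mono) (auto simp: E_def)
    finally show ?thesis .
  qed
  moreover have "norm ((z 1 - z 0) /\<^sub>R \<tau>) = norm (z 1) / \<tau>"
    unfolding norm_scaleR using \<tau> z0 by (simp add: field_simps)
  ultimately have "norm ((z (Suc k) - z k) /\<^sub>R \<tau>)
      \<le> norm ((z 1 - z 0) /\<^sub>R \<tau>) + Theta m \<eta> r a A M f \<phi>0 u u'' z \<tau> k"
    by linarith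
  then show "norm ((z (k + 1) - z k) /\<^sub>R \<tau>)
      \<le> norm ((z 1 - z 0) /\<^sub>R \<tau>) + (\<tau> * (real k * \<tau>)) powr (-1/2) * norm (z 0)
        + Theta m \<eta> r a A M f \<phi>0 u u'' z \<tau> k"
    by (simp only: Suc_eq_plus1 z0 norm_zero mult_zero_right add_0_right)
qed

end
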